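(* Let $\hat{A} \in \mathbb{D}\mathbb{C}^{m \times q}$ and $\hat{B} \in \mathbb{D}\mathbb{C}^{q \times n}$. Then $(\hat{A}\hat{B})^N=\hat{B}^N\hat{A}^N$ if and only if there exists a $\{1,2,3\}$-inverse $\hat{X}$ of $\hat{B}$ satisfying $(\hat{A}\hat{B})^N=\hat{B}^N\hat{B}\hat{X}\hat{A}^N$.
   Context: A dual complex number is $\hat a=a_s+a_d\epsilon$ with $a_s,a_d\in\mathbb{C}$, where $\epsilon$ commutes with complex numbers and $\epsilon^2=0$; it is a dual number if $a_s,a_d\in\mathbb{R}$. A dual number is positive appreciable if $a_s>0$, and positive infinitesimal if $a_s=0$ and $a_d>0$. $\mathbb{D}\mathbb{C}^{m\times n}$ is the set of $m\times n$ dual complex matrices $\hat A=A_s+A_d\epsilon$, $A_s,A_d\in\mathbb{C}^{m\times n}$, and $\hat A^*=A_s^*+A_d^*\epsilon$ (conjugate transpose). $\hat U$ (square) is unitary if $\hat U^*\hat U=\hat U\hat U^*=I$. Known fact (SVD): every $\hat A\in\mathbb{D}\mathbb{C}^{m\times n}$ can be written $\hat A=\hat U\begin{bmatrix}\hat\Sigma_1&O\\O&\hat\Sigma_2\end{bmatrix}\hat V^*$ with $\hat U\in\mathbb{D}\mathbb{C}^{m\times m}$, $\hat V\in\mathbb{D}\mathbb{C}^{n\times n}$ unitary, $\hat\Sigma_1=\mathrm{diag}(\hat\mu_1,\dots,\hat\mu_r)$ with positive appreciable dual numbers on the diagonal, and $\hat\Sigma_2$ a (rectangular) diagonal matrix with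 diagonal entries that are positive infinitesimal dual numbers or zero. The essential part of $\hat A$ is $\hat A_e=\hat U\begin{bmatrix}\hat\Sigma_1&O\\O&O\end{bmatrix}\hat V^*$. For $\hat A\in\mathbb{D}\mathbb{C}^{m\times n}$ and $\hat X\in\mathbb{D}\mathbb{C}^{n\times m}$ consider the equations (1) $\hat A\hat X\hat A=\hat A_e$, (2) $\hat X\hat A\hat X=\hat X$, (3) $(\hat A\hat X)^*=\hat A\hat X$, (4) $(\hat X\hat A)^*=\hat X\hat A$. The new dual Moore-Penrose inverse (NDMPI) $\hat A^N$ of $\hat A$ is the unique $\hat X$ (known to exist for every $\hat A$) satisfying (1)–(4); in terms of the SVD, $\hat A^N=\hat V\begin{bmatrix}\hat\Sigma_1^{-1}&O\\O&O\end{bmatrix}\hat U^*$. A $\{1,2,3\}$-inverse of $\hat A$ is any $\hat X\in\mathbb{D}\mathbb{C}^{n\times m}$ satisfying (1), (2) and (3) (note that equation (1) uses the essential part $\hat A_e$). *)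

theory Defs
  imports "Jordan_Normal_Form.Matrix"
begin

section \<open>Dual complex numbers\<close>

text \<open>\<open>Dual a b\<close> is the dual complex number \<open>a + b \<epsilon>\<close> with \<open>\<epsilon>\<^sup>2 = 0\<close>.\<close>

datatype dual_complex = Dual (std_part: complex) (inf_part: complex)

instantiation dual_complex :: comm_ring_1
begin

definition "0 = Dual 0 0"
definition "1 = Dual 1 0"
definition "- x = Dual (- std_part x) (- inf_part x)"
definition "x + y = Dual (std_part x + std_part y) (inf_part x + inf_part y)"
definition "x - y = Dual (std_part x - std_part y) (inf_part x - inf_part y)"
definition "x * y =
  Dual (std_part x * std_part y) (std_part x * inf_part y + inf_part x * std_part y)"

instance
  by standard
    (auto simp: zero_dual_complex_def one_dual_complex_def uminus_dual_complex_def
      plus_dual_complex_def minus_dual_complex_def times_dual_complex_def algebra_simps)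

end

instantiation dual_complex :: conjugatable_ring
begin

definition "conjugate x = Dual (cnj (std_part x)) (cnj (inf_part x))"

instance
  by standard
    (auto simp: zero_dual_complex_def uminus_dual_complex_def plus_dual_complex_def
      times_dual_complex_def conjugate_dual_complex_def intro: dual_complex.expand)

end

definition is_dual_number :: "dual_complex \<Rightarrow> bool" where
  "is_dual_number x \<longleftrightarrow> std_part x \<in> \<real> \<and> inf_part x \<in> \<real>"

definition positive_appreciable :: "dual_complex \<Rightarrow> bool" where
  "positive_appreciable x \<longleftrightarrow> is_dual_number x \<and> Re (std_part x) > 0"

definition positive_infinitesimal :: "dual_complex \<Rightarrow> bool" where
  "positive_infinitesimal x \<longleftrightarrow> is_dual_number x \<and> std_part x = 0 \<and> Re (inf_part x) > 0"


section \<open>Dual complex matrices\<close>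

text \<open>
  A matrix \<open>A\<^sub>s + A\<^sub>d \<epsilon>\<close> is represented by its entries, which are dual complex numbers.
  The constant \<open>mat_adjoint\<close> of \<open>Jordan_Normal_Form.Schur_Decomposition\<close> is restricted to
  fields and hence not applicable to this ring with zero divisors.
\<close>

definition conj_transpose :: "dual_complex mat \<Rightarrow> dual_complex mat" where
  "conj_transpose A = map_mat conjugate (transpose_mat A)"

definition unitary_dual :: "nat \<Rightarrow> dual_complex mat \<Rightarrow> bool" where
  "unitary_dual n U \<longleftrightarrow>
     U \<in> carrier_mat n n \<and> conj_transpose U * U = 1\<^sub>m n \<and> U * conj_transpose U = 1\<^sub>m n"

definition is_svd :: "dual_complex mat \<Rightarrow> nat \<Rightarrow> dual_complex mat \<Rightarrow> dual_complex mat \<Rightarrow>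
    dual_complex mat \<Rightarrow> dual_complex mat \<Rightarrow> bool" where
  "is_svd A r U S1 S2 V \<longleftrightarrow>
     (let m = dim_row A; n = dim_col A in
        r \<le> m \<and> r \<le> n \<and> unitary_dual m U \<and> unitary_dual n V \<and>
        S1 \<in> carrier_mat r r \<and> diagonal_mat S1 \<and>
        (\<forall>i<r. positive_appreciable (S1 $$ (i, i))) \<and>
        S2 \<in> carrier_mat (m - r) (n - r) \<and> diagonal_mat S2 \<and>
        (\<forall>i<min (m - r) (n - r). positive_infinitesimal (S2 $$ (i, i)) \<or> S2 $$ (i, i) = 0) \<and>
        A = U * four_block_mat S1 (0\<^sub>m r (n - r)) (0\<^sub>m (m - r) r) S2 * conj_transpose V)"

text \<open>Every dual complex matrix has an SVD, and all its SVDs yield the same essential part.\<close>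

definition essential_part :: "dual_complex mat \<Rightarrow> dual_complex mat" where
  "essential_part A = (THE E. \<exists>r U S1 S2 V. is_svd A r U S1 S2 V \<and>
     (let m = dim_row A; n = dim_col A in
        E = U * four_block_mat S1 (0\<^sub>m r (n - r)) (0\<^sub>m (m - r) r) (0\<^sub>m (m - r) (n - r))
              * conj_transpose V))"


section \<open>Generalized inverses\<close>

definition is_123_inverse :: "dual_complex mat \<Rightarrow> dual_complex mat \<Rightarrow> bool" where
  "is_123_inverse A X \<longleftrightarrow>
     X \<in> carrier_mat (dim_col A) (dim_row A) \<and>
     A * X * A = essential_part A \<and>
     X * A * X = X \<and>
     conj_transpose (A * X) = A * X"

definition is_ndmpi :: "dual_complex mat \<Rightarrow> dual_complex mat \<Rightarrow> bool" where
  "is_ndmpi A X \<longleftrightarrow>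
     X \<in> carrier_mat (dim_col A) (dim_row A) \<and>
     A * X * A = essential_part A \<and>
     X * A * X = X \<and>
     conj_transpose (A * X) = A * X \<and>
     conj_transpose (X * A) = X * A"

text \<open>Every dual complex matrix \<open>A\<close> has exactly one \<open>X\<close> with \<open>is_ndmpi A X\<close>.\<close>

definition ndmpi :: "dual_complex mat \<Rightarrow> dual_complex mat" where
  "ndmpi A = (THE X. is_ndmpi A X)"

end

theory Submission
  imports Defs "Jordan_Normal_Form.Spectral_Radius"
begin

text \<open>
  If \<open>X\<close> is a \<open>{1,2,3}\<close>-inverse of \<open>B\<close>, then \<open>B X\<close> and \<open>B B\<^sup>N\<close> are self-adjoint idempotents that
  absorb each other, so they agree and \<open>B\<^sup>N B X = B\<^sup>N\<close>; conversely \<open>B\<^sup>N\<close> itself is a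
  \<open>{1,2,3}\<close>-inverse. For the existence of the SVD, a complex SVD diagonalizes the
  standard part; within the blocks of equal singular values and in the zero block the
  infinitesimal part is diagonalized by further complex unitaries; the remaining entries are removed by unitaries of the form \<open>1 + S \<epsilon>\<close> with \<open>S\<close> skew-Hermitian.
  For uniqueness of the essential part, every SVD yields an \<open>X\<close> satisfying (2)-(4) with
  \<open>A X A\<close> equal to \<open>A\<close> up to an infinitesimal. The standard part of such an \<open>X\<close> is a
  Moore-Penrose inverse, hence unique. The defects \<open>A - A X A\<close> are infinitesimal, so their products
  depend only on standard parts, and the classical uniqueness argument applies once more.
\<close>

section \<open>Adjoints, unitary matrices and unitary equivalence\<close>

lemma assoc_mult_mat_dim:
  "dim_col A = dim_row B \<Longrightarrow> dim_col B = dim_row C \<Longrightarrow> A * B * C = A * (B * C)"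
  for A B C :: "'a :: semiring_0 mat"
  by (rule assoc_mult_mat[of A "dim_row A" "dim_row B" B "dim_row C" C "dim_col C"]) auto

lemma index_mult_mat_sum:
  "i < dim_row A \<Longrightarrow> j < dim_col B \<Longrightarrow> dim_col A = dim_row B \<Longrightarrow>
    (A * B) $$ (i, j) = (\<Sum>k<dim_row B. A $$ (i, k) * B $$ (k, j))"
  by (simp add: scalar_prod_def atLeast0LessThan)

text \<open>Kept polymorphic in the ring, so that the same facts serve the complex standard parts
  and the dual complex matrices, where it coincides with \<open>conj_transpose\<close>.\<close>

definition adjoint_mat :: "'a :: conjugatable_ring mat \<Rightarrow> 'a mat" where
  "adjoint_mat A = map_mat conjugate (transpose_mat A)"

lemma dim_adjoint_mat [simp]:
  "dim_row (adjoint_mat A) = dim_col A" "dim_col (adjoint_mat A) = dim_row A"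
  by (auto simp: adjoint_mat_def)

lemma adjoint_carrier_mat [simp]: "A \<in> carrier_mat m n \<Longrightarrow> adjoint_mat A \<in> carrier_mat n m"
  by (intro carrier_matI) simp_all

lemma index_adjoint_mat [simp]:
  "i < dim_col A \<Longrightarrow> j < dim_row A \<Longrightarrow> adjoint_mat A $$ (i, j) = conjugate (A $$ (j, i))"
  by (auto simp: adjoint_mat_def)

lemma adjoint_adjoint_mat [simp]: "adjoint_mat (adjoint_mat A) = A"
  by (rule eq_matI) auto

lemma adjoint_mat_mult [simp]:
  fixes A B :: "'a :: {conjugatable_ring, comm_ring} mat"
  assumes "dim_col A = dim_row B"
  shows "adjoint_mat (A * B) = adjoint_mat B * adjoint_mat A"
  using assms
  by (intro eq_matI)
    (auto simp: index_mult_mat_sum sum_conjugate conjugate_dist_mul mult.commute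
      simp del: index_mult_mat(1))

text \<open>Conjugation is an involution and respects products, so it fixes the unit: both sides of
  the displayed instance simplify to one of the two values.\<close>

lemma conjugate_one [simp]: "conjugate (1 :: 'a :: {conjugatable_ring, comm_ring_1}) = 1"
proof -
  have "conjugate (conjugate (1 :: 'a) * 1) = conjugate (conjugate 1) * conjugate 1"
    by (rule conjugate_dist_mul)
  then show ?thesis by simp
qed

lemma adjoint_mat_one [simp]: "adjoint_mat (1\<^sub>m n :: 'a :: {conjugatable_ring, comm_ring_1} mat) = 1\<^sub>m n"
  by (rule eq_matI) auto

lemma adjoint_mat_zero [simp]: "adjoint_mat (0\<^sub>m m n) = 0\<^sub>m n m"
  by (rule eq_matI) auto

lemma conj_transpose_eq_adjoint: "conj_transpose = adjoint_mat"
  by (rule ext) (simp add: conj_transpose_def adjoint_mat_def)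

definition unitary_mat :: "nat \<Rightarrow> 'a :: {conjugatable_ring, comm_ring_1} mat \<Rightarrow> bool" where
  "unitary_mat n U \<longleftrightarrow>
     U \<in> carrier_mat n n \<and> adjoint_mat U * U = 1\<^sub>m n \<and> U * adjoint_mat U = 1\<^sub>m n"

lemma unitary_dual_eq: "unitary_dual = unitary_mat"
  by (intro ext) (simp add: unitary_dual_def unitary_mat_def conj_transpose_eq_adjoint)

lemma unitary_matD:
  assumes "unitary_mat n U"
  shows "U \<in> carrier_mat n n" "dim_row U = n" "dim_col U = n"
    "adjoint_mat U * U = 1\<^sub>m n" "U * adjoint_mat U = 1\<^sub>m n"
  using assms by (auto simp: unitary_mat_def)

lemma unitary_mat_cancel:
  assumes "unitary_mat n U" "dim_row X = n"
  shows "adjoint_mat U * (U * X) = X" "U * (adjoint_mat U * X) = X"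
  using assms
  by (auto simp: unitary_mat_def assoc_mult_mat_dim[symmetric] simp del: assoc_mult_mat)

lemma unitary_mat_one [simp]: "unitary_mat n (1\<^sub>m n)"
  by (simp add: unitary_mat_def)

lemma unitary_mat_mult:
  assumes U: "unitary_mat n U" and V: "unitary_mat n V"
  shows "unitary_mat n (U * V)"
  using unitary_matD[OF U] unitary_matD[OF V]
  by (simp add: unitary_mat_def assoc_mult_mat_dim unitary_mat_cancel[OF U] unitary_mat_cancel[OF V])

section \<open>Block-diagonal matrices\<close>

definition block_diag :: "'a :: zero mat \<Rightarrow> 'a mat \<Rightarrow> 'a mat" where
  "block_diag A D = four_block_mat A (0\<^sub>m (dim_row A) (dim_col D)) (0\<^sub>m (dim_row D) (dim_col A)) D"

lemma dim_block_diag [simp]: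
  "dim_row (block_diag A D) = dim_row A + dim_row D"
  "dim_col (block_diag A D) = dim_col A + dim_col D"
  by (auto simp: block_diag_def)

lemma index_block_diag:
  assumes "i < dim_row A + dim_row D" "j < dim_col A + dim_col D"
  shows "block_diag A D $$ (i, j) =
    (if i < dim_row A then if j < dim_col A then A $$ (i, j) else 0
     else if j < dim_col A then 0 else D $$ (i - dim_row A, j - dim_col A))"
  using assms by (auto simp: block_diag_def)

lemma four_block_mat_mult_block_diag:
  fixes P Q :: "'a :: semiring_0 mat"
  assumes "A \<in> carrier_mat m1 n1" "B \<in> carrier_mat m1 n2" "C \<in> carrier_mat m2 n1" "D \<in> carrier_mat m2 n2"
    and "P \<in> carrier_mat n1 k1" "Q \<in> carrier_mat n2 k2"
  shows "four_block_mat A B C D * block_diag P Q = four_block_mat (A * P) (B * Q) (C * P) (D * Q)"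
  using assms
  by (subst block_diag_def, subst mult_four_block_mat[of A m1 n1 B n2 C m2 D P k1 _ k2]) auto

lemma block_diag_mult_four_block_mat:
  fixes P Q :: "'a :: semiring_0 mat"
  assumes "A \<in> carrier_mat m1 n1" "B \<in> carrier_mat m1 n2" "C \<in> carrier_mat m2 n1" "D \<in> carrier_mat m2 n2"
    and "P \<in> carrier_mat k1 m1" "Q \<in> carrier_mat k2 m2"
  shows "block_diag P Q * four_block_mat A B C D = four_block_mat (P * A) (P * B) (Q * C) (Q * D)"
  using assms
  by (subst block_diag_def, subst mult_four_block_mat[of P k1 m1 _ m2 _ k2 Q A n1 B n2]) auto

lemma block_diag_mult [simp]:
  fixes A B C D :: "'a :: semiring_0 mat"
  assumes "dim_col A = dim_row B" "dim_col C = dim_row D"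
  shows "block_diag A C * block_diag B D = block_diag (A * B) (C * D)"
  using assms unfolding block_diag_def
  by (subst mult_four_block_mat[of A "dim_row A" "dim_row B" _ "dim_row D" _ "dim_row C" C
        B "dim_col B" _ "dim_col D"]) auto

lemma adjoint_block_diag [simp]: "adjoint_mat (block_diag A D) = block_diag (adjoint_mat A) (adjoint_mat D)"
  by (rule eq_matI) (auto simp: index_block_diag)

lemma block_diag_one [simp]: "block_diag (1\<^sub>m m) (1\<^sub>m n) = 1\<^sub>m (m + n)"
  by (rule eq_matI) (auto simp: index_block_diag)

lemma unitary_block_diag: "unitary_mat m U \<Longrightarrow> unitary_mat n V \<Longrightarrow> unitary_mat (m + n) (block_diag U V)"
  by (auto simp: unitary_mat_def)

section \<open>Unitary equivalence\<close>

text \<open>The two unitaries are independent of each other, as in an SVD; this is not unitary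
  similarity and makes sense for rectangular matrices.\<close>

definition unitarily_equivalent ::
  "'a :: {conjugatable_ring, comm_ring_1} mat \<Rightarrow> 'a mat \<Rightarrow> bool" where
  "unitarily_equivalent A B \<longleftrightarrow> (\<exists>U V. unitary_mat (dim_row B) U \<and> unitary_mat (dim_col B) V \<and>
     A = U * B * adjoint_mat V)"

lemma unitarily_equivalentI:
  assumes "B \<in> carrier_mat m n" "unitary_mat m U" "unitary_mat n V" "A = U * B * adjoint_mat V"
  shows "unitarily_equivalent A B"
  using assms unfolding unitarily_equivalent_def by blast

lemma unitarily_equivalentE:
  assumes "unitarily_equivalent A B" "B \<in> carrier_mat m n"
  obtains U V where "unitary_mat m U" "unitary_mat n V" "A = U * B * adjoint_mat V"
  using assms unfolding unitarily_equivalent_def by blast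

lemma unitarily_equivalent_dim:
  assumes "unitarily_equivalent A B"
  shows "dim_row A = dim_row B" "dim_col A = dim_col B"
  using assms by (auto simp: unitarily_equivalent_def unitary_mat_def)

lemma unitarily_equivalent_refl [simp]: "unitarily_equivalent A A"
  by (rule unitarily_equivalentI[of A "dim_row A" "dim_col A" "1\<^sub>m (dim_row A)" "1\<^sub>m (dim_col A)"]) auto

lemma unitarily_equivalent_trans:
  assumes "unitarily_equivalent A B" "unitarily_equivalent B C"
  shows "unitarily_equivalent A C"
proof -
  define m n where "m = dim_row C" and "n = dim_col C"
  have C: "C \<in> carrier_mat m n" and B: "B \<in> carrier_mat m n"
    using unitarily_equivalent_dim[OF assms(2)] by (auto simp: m_def n_def)
  obtain U V where U: "unitary_mat m U" and V: "unitary_mat n V" and A: "A = U * B * adjoint_mat V"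
    using assms(1) B by (rule unitarily_equivalentE)
  obtain U' V' where U': "unitary_mat m U'" and V': "unitary_mat n V'" and B': "B = U' * C * adjoint_mat V'"
    using assms(2) C by (rule unitarily_equivalentE)
  have "A = (U * U') * C * adjoint_mat (V * V')"
    using A B' C unitary_matD[OF U] unitary_matD[OF U'] unitary_matD[OF V] unitary_matD[OF V']
    by (simp add: assoc_mult_mat_dim)
  then show ?thesis
    by (intro unitarily_equivalentI[OF C unitary_mat_mult[OF U U'] unitary_mat_mult[OF V V']])
qed

lemma unitarily_equivalent_conj:
  assumes "A \<in> carrier_mat m n" "unitary_mat m U" "unitary_mat n V"
  shows "unitarily_equivalent A (adjoint_mat U * A * V)"
  by (rule unitarily_equivalentI[OF _ assms(2,3)])
    (use assms unitary_matD[OF assms(2)] unitary_matD[OF assms(3)] in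
      \<open>auto simp: assoc_mult_mat_dim unitary_mat_cancel(2)[OF assms(2)]\<close>)

lemma unitarily_equivalent_block_diag:
  assumes "unitarily_equivalent A B" "unitarily_equivalent C D"
  shows "unitarily_equivalent (block_diag A C) (block_diag B D)"
proof -
  obtain U V where U: "unitary_mat (dim_row B) U" and V: "unitary_mat (dim_col B) V"
    and A: "A = U * B * adjoint_mat V"
    using assms(1) by (auto simp: unitarily_equivalent_def)
  obtain U' V' where U': "unitary_mat (dim_row D) U'" and V': "unitary_mat (dim_col D) V'"
    and C: "C = U' * D * adjoint_mat V'"
    using assms(2) by (auto simp: unitarily_equivalent_def)
  show ?thesis
    by (rule unitarily_equivalentI[OF _ unitary_block_diag[OF U U'] unitary_block_diag[OF V V']])
      (use A C unitary_matD[OF U] unitary_matD[OF U'] unitary_matD[OF V] unitary_matD[OF V'] in auto)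
qed

section \<open>Normal matrices and the complex singular value decomposition\<close>

lemma sum_delta_lessThan:
  "k < (n :: nat) \<Longrightarrow> (\<Sum>i<n. (if i = k then f i else 0)) = f k"
  "k < (n :: nat) \<Longrightarrow> (\<Sum>i<n. (if k = i then f i else 0)) = f k"
  by (simp_all add: sum.delta sum.delta')

text \<open>Over a field a one-sided inverse of a square matrix is two-sided, so orthonormality of
  the columns suffices.\<close>

lemma unitary_matI_field:
  fixes U :: "'a :: conjugatable_field mat"
  assumes "U \<in> carrier_mat n n" "adjoint_mat U * U = 1\<^sub>m n"
  shows "unitary_mat n U"
  using assms mat_mult_left_right_inverse[of "adjoint_mat U" n U] by (auto simp: unitary_mat_def)

text \<open>The unitary matrix is a Householder reflection times a phase; the phase makes the \<open>k\<close>-th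
  entry of the rotated vector nonnegative, so that the reflection vector does not vanish.\<close>

lemma unitary_mat_with_column:
  fixes v :: "nat \<Rightarrow> complex"
  assumes k: "k < n" and v: "(\<Sum>i<n. v i * cnj (v i)) = 1"
  obtains W where "unitary_mat n W" "\<And>i. i < n \<Longrightarrow> W $$ (i, k) = v i"
proof -
  define \<rho> :: complex where "\<rho> = of_real (cmod (v k))"
  \<comment> \<open>\<open>p\<close> is the phase of \<open>v k\<close>, with default 1 when
    \<open>v k = 0\<close>; multiplication by \<open>cnj p\<close> turns entry \<open>k\<close> into
    its modulus \<open>\<rho>\<close>.\<close>
  define p where "p = (if v k = 0 then 1 else v k / \<rho>)"
  have nv: "v k * cnj (v k) = \<rho> * \<rho>"
    unfolding \<rho>_def using complex_norm_square[of "v k"] by (simp add: power2_eq_square)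
  have "\<rho> \<noteq> 0" if "v k \<noteq> 0" using that by (simp add: \<rho>_def)
  moreover have "cnj \<rho> = \<rho>" by (simp add: \<rho>_def)
  ultimately have pp: "p * cnj p = 1" and vk: "cnj p * v k = \<rho>"
    using nv by (auto simp: p_def mult.commute)
  have rho: "1 + \<rho> \<noteq> 0" "cnj \<rho> = \<rho>"
  proof -
    have "Re (1 + \<rho>) > 0" by (simp add: \<rho>_def add_pos_nonneg)
    then show "1 + \<rho> \<noteq> 0" by (metis less_irrefl zero_complex.sel(1))
  qed (simp add: \<rho>_def)
  \<comment> \<open>\<open>w\<close> is the rotated vector plus the \<open>k\<close>-th unit vector,
    of squared norm \<open>2 * (1 + \<rho>)\<close>. Hence w w*/(1 + \<rho>) - I is a Hermitian
    unitary matrix exchanging these two vectors, and the factor \<open>p\<close> in \<open>W\<close>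
    undoes the rotation.\<close>
  define w where "w i = cnj p * v i + (if i = k then 1 else 0)" for i
  have wk: "w k = 1 + \<rho>" by (simp add: w_def vk)
  have "w i * cnj (w i) = v i * cnj (v i) + (if i = k then 1 + 2 * \<rho> else 0)" for i
    using pp vk arg_cong[OF vk, of cnj] rho(2)
    by (auto simp: w_def algebra_simps)
  then have ww: "(\<Sum>i<n. w i * cnj (w i)) = 2 * (1 + \<rho>)"
    using v k by (simp add: sum.distrib sum_delta_lessThan algebra_simps)
  define W where "W = mat n n (\<lambda>(i, j). p * (w i * cnj (w j) / (1 + \<rho>) - (if i = j then 1 else 0)))"
  have W: "W \<in> carrier_mat n n" by (simp add: W_def)
  have aux: "2 * c * (x / c\<^sup>2) - x / c - x / c + d = d" if "c \<noteq> 0" for c x d :: complex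
    using that by (simp add: field_simps power2_eq_square)
  have "adjoint_mat W * W = 1\<^sub>m n"
  proof (rule eq_matI)
    fix i j assume "i < dim_row (1\<^sub>m n :: complex mat)" "j < dim_col (1\<^sub>m n :: complex mat)"
    then have i: "i < n" and j: "j < n" by auto
    have "(adjoint_mat W * W) $$ (i, j) = (\<Sum>l<n. cnj (W $$ (l, i)) * W $$ (l, j))"
      using W i j by (simp add: index_mult_mat_sum del: index_mult_mat(1))
    also have "\<dots> = (\<Sum>l<n. (w l * cnj (w l)) * (w i * cnj (w j) / (1 + \<rho>)\<^sup>2)
         - (if l = j then w i * cnj (w l) / (1 + \<rho>) else 0) - (if l = i then w l * cnj (w j) / (1 + \<rho>) else 0)
         + (if l = i then if i = j then 1 else 0 else 0))"
    proof (rule sum.cong[OF refl])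
      fix l assume "l \<in> {..<n}"
      then have "cnj (W $$ (l, i)) * W $$ (l, j) =
          (p * cnj p) * ((w i * cnj (w l) / (1 + \<rho>) - (if l = i then 1 else 0)) *
                 (w l * cnj (w j) / (1 + \<rho>) - (if l = j then 1 else 0)))"
        using i j rho(2) by (simp add: W_def)
      also have "\<dots> = (w l * cnj (w l)) * (w i * cnj (w j) / (1 + \<rho>)\<^sup>2)
         - (if l = j then w i * cnj (w l) / (1 + \<rho>) else 0) - (if l = i then w l * cnj (w j) / (1 + \<rho>) else 0)
         + (if l = i then if i = j then 1 else 0 else 0)"
        unfolding pp by (auto simp: algebra_simps power2_eq_square)
      finally show "cnj (W $$ (l, i)) * W $$ (l, j) = \<dots>" .
    qed
    also have "\<dots> = 2 * (1 + \<rho>) * (w i * cnj (w j) / (1 + \<rho>)\<^sup>2) - w i * cnj (w j) / (1 + \<rho>)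
        - w i * cnj (w j) / (1 + \<rho>) + (if i = j then 1 else 0)"
      using i j by (simp add: sum.distrib sum_subtractf sum_distrib_right[symmetric] sum_divide_distrib[symmetric] ww sum_delta_lessThan)
    also have "\<dots> = (if i = j then 1 else 0)"
      using aux[OF rho(1)] .
    finally show "(adjoint_mat W * W) $$ (i, j) = 1\<^sub>m n $$ (i, j)" using i j by simp
  qed (use W in auto)
  then have "unitary_mat n W" by (rule unitary_matI_field[OF W])
  moreover have "W $$ (i, k) = v i" if "i < n" for i
  proof -
    have "W $$ (i, k) = p * (w i - (if i = k then 1 else 0))"
      using that k rho by (simp add: W_def wk)
    also have "\<dots> = (p * cnj p) * v i" by (simp add: w_def)
    finally show ?thesis by (simp add: pp)
  qed
  ultimately show thesis by (rule that)
qed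

section \<open>Eigenvectors and diagonalization of normal matrices\<close>

lemma unit_eigenvector_exists:
  fixes H :: "complex mat"
  assumes H: "H \<in> carrier_mat n n" and n: "n > 0"
  obtains \<mu> v where "(\<Sum>i<n. v i * cnj (v i)) = 1"
    "\<And>i. i < n \<Longrightarrow> (\<Sum>j<n. H $$ (i, j) * v j) = \<mu> * v i"
proof -
  obtain \<mu> x where x: "x \<in> carrier_vec n" "x \<noteq> 0\<^sub>v n" and ev: "H *\<^sub>v x = \<mu> \<cdot>\<^sub>v x"
    using spectrum_non_empty[OF H n] H by (auto simp: spectrum_def eigenvalue_def eigenvector_def)
  define s where "s = (\<Sum>i<n. (cmod (x $ i))\<^sup>2)"
  have "s \<noteq> 0"
  proof
    assume "s = 0"
    then have "\<forall>i<n. x $ i = 0" by (simp add: s_def sum_nonneg_eq_0_iff)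
    then show False using x by (auto intro: eq_vecI)
  qed
  then have s: "s > 0" by (simp add: s_def sum_nonneg order_less_le)
  define c :: complex where "c = of_real (1 / sqrt s)"
  have cc: "c * cnj c * of_real s = 1"
    using s by (simp add: c_def flip: of_real_mult)
  have "(\<Sum>i<n. (c * x $ i) * cnj (c * x $ i)) = (\<Sum>i<n. (c * cnj c) * (x $ i * cnj (x $ i)))"
    by (simp add: mult_ac)
  also have "\<dots> = c * cnj c * of_real s"
    unfolding s_def of_real_sum complex_norm_square sum_distrib_left ..
  also note cc
  finally have 1: "(\<Sum>i<n. (c * x $ i) * cnj (c * x $ i)) = 1" .
  have 2: "(\<Sum>j<n. H $$ (i, j) * (c * x $ j)) = \<mu> * (c * x $ i)" if i: "i < n" for i
  proof -
    have "(\<Sum>j<n. H $$ (i, j) * x $ j) = (H *\<^sub>v x) $ i"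
      using i H x by (auto simp: scalar_prod_def atLeast0LessThan)
    then have "(\<Sum>j<n. H $$ (i, j) * x $ j) = \<mu> * x $ i" using ev i x by simp
    then have "c * (\<Sum>j<n. H $$ (i, j) * x $ j) = c * (\<mu> * x $ i)" by simp
    then show ?thesis by (simp add: sum_distrib_left mult_ac)
  qed
  show thesis using 1 2 by (rule that)
qed

text \<open>A unit eigenvector is completed to a unitary matrix. The eigenvalue is fixed before the
  column \<open>k\<close>, so that a caller can first inspect \<open>\<mu>\<close> and then decide
  where the eigenvector goes.\<close>

lemma schur_step:
  fixes H :: "complex mat"
  assumes H: "H \<in> carrier_mat n n" and n: "n > 0"
  obtains \<mu> where "\<And>k. k < n \<Longrightarrow> \<exists>W. unitary_mat n W \<and>
    (\<forall>j<n. (adjoint_mat W * H * W) $$ (j, k) = (if j = k then \<mu> else 0))"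
proof -
  obtain \<mu> v where v: "(\<Sum>i<n. v i * cnj (v i)) = 1"
    and ev: "\<And>i. i < n \<Longrightarrow> (\<Sum>j<n. H $$ (i, j) * v j) = \<mu> * v i"
    using unit_eigenvector_exists[OF H n] by blast
  have "\<exists>W. unitary_mat n W \<and> (\<forall>j<n. (adjoint_mat W * H * W) $$ (j, k) = (if j = k then \<mu> else 0))"
    if k: "k < n" for k
  proof -
    obtain W where W: "unitary_mat n W" and Wk: "\<And>i. i < n \<Longrightarrow> W $$ (i, k) = v i"
      using unitary_mat_with_column[OF k v] by blast
    have HW: "(H * W) $$ (i, k) = \<mu> * W $$ (i, k)" if "i < n" for i
      using H unitary_matD[OF W] k that ev[OF that] Wk
      by (simp add: index_mult_mat_sum del: index_mult_mat(1))
    have "(adjoint_mat W * H * W) $$ (j, k) = (if j = k then \<mu> else 0)" if j: "j < n" for j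
    proof -
      have "(adjoint_mat W * H * W) $$ (j, k) = (adjoint_mat W * (H * W)) $$ (j, k)"
        using H unitary_matD[OF W] by (simp add: assoc_mult_mat_dim)
      also have "\<dots> = (\<Sum>i<n. adjoint_mat W $$ (j, i) * (\<mu> * W $$ (i, k)))"
        using H unitary_matD[OF W] j k HW
        by (subst index_mult_mat_sum) (auto simp del: index_mult_mat(1))
      also have "\<dots> = \<mu> * (adjoint_mat W * W) $$ (j, k)"
        using unitary_matD(1-3)[OF W] j k
        by (simp add: index_mult_mat_sum sum_distrib_left mult_ac del: index_mult_mat(1))
      finally show ?thesis using unitary_matD(4)[OF W] j k by auto
    qed
    with W show ?thesis by blast
  qed
  then show thesis by (rule that)
qed

lemma split_first:
  assumes A: "A \<in> carrier_mat (Suc m) (Suc n)"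
    and "\<And>j. 0 < j \<Longrightarrow> j < Suc m \<Longrightarrow> A $$ (j, 0) = 0"
    and "\<And>j. 0 < j \<Longrightarrow> j < Suc n \<Longrightarrow> A $$ (0, j) = 0"
  shows "A = block_diag (mat 1 1 (\<lambda>_. A $$ (0, 0))) (mat m n (\<lambda>(i, j). A $$ (Suc i, Suc j)))"
  using assms by (intro eq_matI) (auto simp: index_block_diag)

lemma block_diag_inject:
  assumes "dim_row A = dim_row B" "dim_col A = dim_col B" "dim_row C = dim_row D" "dim_col C = dim_col D"
    and "block_diag A C = block_diag B D"
  shows "A = B" "C = D"
proof -
  have *: "block_diag A C $$ (i, j) = block_diag B D $$ (i, j)" for i j using assms(5) by simp
  show "A = B"
    using *[of i j for i j] assms(1-4)
    by (intro eq_matI) (metis dim_block_diag index_block_diag trans_less_add1)+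
  show "C = D"
  proof (rule eq_matI)
    fix i j assume "i < dim_row D" "j < dim_col D"
    then show "C $$ (i, j) = D $$ (i, j)"
      using *[of "i + dim_row A" "j + dim_col A"] assms(1-4) by (simp add: index_block_diag)
  qed (use assms in auto)
qed

text \<open>Induction on the size. A Schur step clears the first column below the diagonal;
  normality equates the norms of first row and first column, so the rest of the row vanishes too.
  The remaining block is again normal.\<close>

theorem normal_mat_unitarily_diagonalizable:
  fixes N :: "complex mat"
  assumes "N \<in> carrier_mat n n" "adjoint_mat N * N = N * adjoint_mat N"
  shows "\<exists>W. unitary_mat n W \<and> diagonal_mat (adjoint_mat W * N * W)"
  using assms
proof (induction n arbitrary: N)
  case 0
  then show ?case by (intro exI[of _ "1\<^sub>m 0"]) (auto simp: diagonal_mat_def)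
next
  case (Suc n)
  note N = Suc.prems(1) and normal = Suc.prems(2)
  obtain \<mu> W where W: "unitary_mat (Suc n) W"
    and col0: "\<And>j. j < Suc n \<Longrightarrow> (adjoint_mat W * N * W) $$ (j, 0) = (if j = 0 then \<mu> else 0)"
    using schur_step[OF N] by (metis zero_less_Suc)
  define M where "M = adjoint_mat W * N * W"
  note Wd = unitary_matD[OF W]
  have M: "M \<in> carrier_mat (Suc n) (Suc n)" using N Wd by (auto simp: M_def)
  have Mn: "adjoint_mat M * M = M * adjoint_mat M"
  proof -
    have "adjoint_mat M * M = adjoint_mat W * (adjoint_mat N * N) * W"
      using N Wd(2,3) by (simp add: M_def assoc_mult_mat_dim unitary_mat_cancel[OF W])
    also have "\<dots> = M * adjoint_mat M"
      unfolding normal using N Wd(2,3) by (simp add: M_def assoc_mult_mat_dim unitary_mat_cancel[OF W])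
    finally show ?thesis .
  qed
  have "(adjoint_mat M * M) $$ (0, 0) = (\<Sum>k<Suc n. cnj (M $$ (k, 0)) * M $$ (k, 0))"
    using M by (subst index_mult_mat_sum) (auto intro!: sum.cong)
  then have "(adjoint_mat M * M) $$ (0, 0) = cnj \<mu> * \<mu>"
    by (simp add: sum.lessThan_Suc_shift col0[folded M_def] del: sum.lessThan_Suc index_mult_mat(1))
  moreover have "(M * adjoint_mat M) $$ (0, 0) = (\<Sum>k<Suc n. M $$ (0, k) * cnj (M $$ (0, k)))"
    using M by (subst index_mult_mat_sum) (auto intro!: sum.cong)
  ultimately have "(\<Sum>k<Suc n. M $$ (0, k) * cnj (M $$ (0, k))) = cnj \<mu> * \<mu>"
    using Mn by simp
  then have "(\<Sum>k<n. M $$ (0, Suc k) * cnj (M $$ (0, Suc k))) = 0"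
    by (simp add: sum.lessThan_Suc_shift col0[folded M_def] del: sum.lessThan_Suc)
  then have "complex_of_real (\<Sum>k<n. (cmod (M $$ (0, Suc k)))\<^sup>2) = 0"
    by (simp only: of_real_sum complex_norm_square)
  then have row0: "M $$ (0, Suc k) = 0" if "k < n" for k
    using that by (simp only: of_real_eq_0_iff) (simp add: sum_nonneg_eq_0_iff)
  define M' where "M' = mat n n (\<lambda>(i, j). M $$ (Suc i, Suc j))"
  define L where "L = mat 1 1 (\<lambda>_. M $$ (0, 0))"
  have M_eq: "M = block_diag L M'"
    unfolding M'_def L_def
    by (rule split_first[OF M]) (use row0 in \<open>auto simp: col0[folded M_def] gr0_conv_Suc\<close>)
  have M': "M' \<in> carrier_mat n n" and L: "L \<in> carrier_mat 1 1" by (auto simp: M'_def L_def)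
  have "adjoint_mat M' * M' = M' * adjoint_mat M'"
  proof (rule block_diag_inject(2))
    show "block_diag (adjoint_mat L * L) (adjoint_mat M' * M') = block_diag (L * adjoint_mat L) (M' * adjoint_mat M')"
      using Mn M'(1) L by (simp add: M_eq)
  qed (use L M' in simp_all)
  then obtain W' where W': "unitary_mat n W'" and D: "diagonal_mat (adjoint_mat W' * M' * W')"
    using Suc.IH[OF M'] by blast
  define V where "V = W * block_diag (1\<^sub>m 1) W'"
  have 1: "unitary_mat (Suc n) (block_diag (1\<^sub>m 1) W')"
    using unitary_block_diag[OF unitary_mat_one[of 1] W'] by simp
  have "unitary_mat (Suc n) V" unfolding V_def by (rule unitary_mat_mult[OF W 1])
  moreover have "adjoint_mat V * N * V = adjoint_mat (block_diag (1\<^sub>m 1) W') * M * block_diag (1\<^sub>m 1) W'"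
    using N Wd(2,3) unitary_matD(2,3)[OF 1] by (simp add: V_def M_def assoc_mult_mat_dim)
  then have "adjoint_mat V * N * V = block_diag L (adjoint_mat W' * M' * W')"
    using L M' unitary_matD(2,3)[OF W'] by (simp add: M_eq)
  then have "diagonal_mat (adjoint_mat V * N * V)"
    using D L M' unitary_matD(2,3)[OF W'] by (auto simp: diagonal_mat_def index_block_diag)
  ultimately show ?case by blast
qed

section \<open>Singular value decomposition of complex matrices\<close>

text \<open>The values are not ordered, and those of \<open>\<sigma>\<close> from index
  \<open>r\<close> on are ignored. With all three sizes equal it is a real diagonal matrix.\<close>

definition singular_value_mat :: "nat \<Rightarrow> nat \<Rightarrow> nat \<Rightarrow> (nat \<Rightarrow> real) \<Rightarrow> complex mat" where
  "singular_value_mat m n r \<sigma> = mat m n (\<lambda>(i, j). if i = j \<and> i < r then of_real (\<sigma> i) else 0)"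

lemma singular_value_mat_carrier [simp]: "singular_value_mat m n r \<sigma> \<in> carrier_mat m n"
  by (simp add: singular_value_mat_def)

lemma dim_singular_value_mat [simp]:
  "dim_row (singular_value_mat m n r \<sigma>) = m" "dim_col (singular_value_mat m n r \<sigma>) = n"
  by (simp_all add: singular_value_mat_def)

lemma index_singular_value_mat [simp]:
  "i < m \<Longrightarrow> j < n \<Longrightarrow>
    singular_value_mat m n r \<sigma> $$ (i, j) = (if i = j \<and> i < r then of_real (\<sigma> i) else 0)"
  by (simp add: singular_value_mat_def)

text \<open>Induction on the number of columns, with an eigenvalue \<open>\<mu>\<close> of A*A. If
  it is zero, a kernel vector splits off a zero column. Otherwise a unitary \<open>V\<close> makes
  the first column of \<open>A * V\<close> orthogonal to the others, and a unitary with that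
  normalized column as its first splits off a 1 by 1 block.\<close>

theorem complex_svd:
  fixes A :: "complex mat"
  assumes "A \<in> carrier_mat m n"
  shows "\<exists>r \<sigma>. r \<le> m \<and> r \<le> n \<and> (\<forall>i<r. \<sigma> i > 0) \<and>
    unitarily_equivalent A (singular_value_mat m n r \<sigma>)"
  using assms
proof (induction n arbitrary: m A)
  case 0
  then have "A = singular_value_mat m 0 0 (\<lambda>_. 0)" by (intro eq_matI) auto
  then show ?case by (intro exI[of _ 0] exI[of _ "\<lambda>_. 0"]) simp
next
  case (Suc n)
  note A = Suc.prems
  define H where "H = adjoint_mat A * A"
  have H: "H \<in> carrier_mat (Suc n) (Suc n)" using A by (auto simp: H_def)
  obtain \<mu> where \<mu>: "\<And>k. k < Suc n \<Longrightarrow> \<exists>W. unitary_mat (Suc n) W \<and>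
    (\<forall>j<Suc n. (adjoint_mat W * H * W) $$ (j, k) = (if j = k then \<mu> else 0))"
    using schur_step[OF H] by blast
  have conj: "adjoint_mat W * H * W = adjoint_mat (A * W) * (A * W)" if "unitary_mat (Suc n) W" for W
    using A unitary_matD[OF that] by (simp add: H_def assoc_mult_mat_dim)
  have norm_col: "complex_of_real (\<Sum>i<m. (cmod (M $$ (i, k)))\<^sup>2) = (adjoint_mat M * M) $$ (k, k)"
    if "M \<in> carrier_mat m (Suc n)" "k < Suc n" for M k
    unfolding of_real_sum complex_norm_square using that
    by (subst index_mult_mat_sum) (auto simp: mult.commute)
  show ?case
  proof (cases "\<mu> = 0")
    case True
    \<comment> \<open>The kernel vector goes into the last column, so that dropping the resulting
      zero column leaves the singular values in the upper left corner.\<close>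
    obtain V where V: "unitary_mat (Suc n) V"
      and "\<forall>j<Suc n. (adjoint_mat V * H * V) $$ (j, n) = (if j = n then \<mu> else 0)"
      using \<mu>[of n] by auto
    then have "(adjoint_mat (A * V) * (A * V)) $$ (n, n) = 0" using conj[OF V] True by simp
    then have "(\<Sum>i<m. (cmod ((A * V) $$ (i, n)))\<^sup>2) = 0"
      using norm_col[of "A * V" n] A unitary_matD(1-3)[OF V]
      by (metis lessI mult_carrier_mat of_real_eq_0_iff)
    then have last: "(A * V) $$ (i, n) = 0" if "i < m" for i
      using that by (simp add: sum_nonneg_eq_0_iff del: index_mult_mat(1))
    define A' where "A' = mat m n (\<lambda>(i, j). (A * V) $$ (i, j))"
    have A': "A' \<in> carrier_mat m n" by (simp add: A'_def)
    obtain r \<sigma> where r: "r \<le> m" "r \<le> n" "\<forall>i<r. \<sigma> i > 0"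
      and equiv: "unitarily_equivalent A' (singular_value_mat m n r \<sigma>)"
      using Suc.IH[OF A'] by blast
    \<comment> \<open>A block with no rows and one column appends a zero column without adding a
      row.\<close>
    have "A * V = block_diag A' (0\<^sub>m 0 1)"
      using A unitary_matD(1-3)[OF V] last
      by (intro eq_matI) (auto simp: A'_def index_block_diag less_Suc_eq simp del: index_mult_mat(1))
    moreover have "singular_value_mat m (Suc n) r \<sigma> = block_diag (singular_value_mat m n r \<sigma>) (0\<^sub>m 0 1)"
      using r by (intro eq_matI) (auto simp: index_block_diag)
    moreover have "unitarily_equivalent (block_diag A' (0\<^sub>m 0 1)) (block_diag (singular_value_mat m n r \<sigma>) (0\<^sub>m 0 1))"
      by (rule unitarily_equivalent_block_diag[OF equiv]) simp
    moreover have "unitarily_equivalent A (A * V)"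
      using unitarily_equivalent_conj[OF A unitary_mat_one V] A by simp
    ultimately have "unitarily_equivalent A (singular_value_mat m (Suc n) r \<sigma>)"
      by (metis unitarily_equivalent_trans)
    then show ?thesis using r by (intro exI[of _ r] exI[of _ \<sigma>]) simp
  next
    case False
    obtain V where V: "unitary_mat (Suc n) V"
      and "\<forall>j<Suc n. (adjoint_mat V * H * V) $$ (j, 0) = (if j = 0 then \<mu> else 0)"
      using \<mu>[of 0] by auto
    then have col0: "\<forall>j<Suc n. (adjoint_mat (A * V) * (A * V)) $$ (j, 0) = (if j = 0 then \<mu> else 0)"
      using conj[OF V] by simp
    define M where "M = A * V"
    have M: "M \<in> carrier_mat m (Suc n)" using A unitary_matD(1)[OF V] by (simp add: M_def)
    define t where "t = (\<Sum>i<m. (cmod (M $$ (i, 0)))\<^sup>2)"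
    \<comment> \<open>The eigenvalue is the squared norm of the first column of \<open>M\<close>,
      hence a positive real number; its root \<open>s\<close> is the new singular value.\<close>
    have t: "complex_of_real t = \<mu>" using norm_col[OF M, of 0] col0 by (simp add: t_def M_def)
    have "t \<noteq> 0" using t False by auto
    moreover have "t \<ge> 0" by (simp add: t_def sum_nonneg)
    ultimately have "t > 0" by simp
    define s where "s = sqrt t"
    have s: "s > 0" "s * s = t" using \<open>t > 0\<close> by (simp_all add: s_def)
    have m: "m > 0" using \<open>t > 0\<close> by (cases m) (auto simp: t_def)
    then obtain m' where m': "m = Suc m'" by (cases m) auto
    define u where "u i = M $$ (i, 0) / of_real s" for i
    have "(\<Sum>i<m. u i * cnj (u i)) = of_real t / of_real (s * s)"
      unfolding t_def of_real_sum complex_norm_square by (simp add: u_def sum_divide_distrib)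
    then have "(\<Sum>i<m. u i * cnj (u i)) = 1" using s \<open>t > 0\<close> by simp
    then obtain U where U: "unitary_mat m U" and Uk: "\<And>i. i < m \<Longrightarrow> U $$ (i, 0) = u i"
      using unitary_mat_with_column[OF m] by blast
    define B where "B = adjoint_mat U * M"
    have B: "B \<in> carrier_mat m (Suc n)" using M unitary_matD(1)[OF U] by (auto simp: B_def)
    have Bc: "B $$ (i, 0) = (if i = 0 then of_real s else 0)" if i: "i < m" for i
    proof -
      have "B $$ (i, 0) = (\<Sum>k<m. adjoint_mat U $$ (i, k) * (of_real s * U $$ (k, 0)))"
        unfolding B_def using M unitary_matD(1-3)[OF U] i s
        by (subst index_mult_mat_sum) (auto simp: Uk u_def intro!: sum.cong)
      also have "\<dots> = of_real s * (adjoint_mat U * U) $$ (i, 0)"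
        using unitary_matD(1-3)[OF U] i m
        by (subst index_mult_mat_sum) (auto simp: sum_distrib_left mult_ac)
      finally show ?thesis using unitary_matD(4)[OF U] i m by auto
    qed
    \<comment> \<open>The unitary factor preserves inner products of columns. As the first column of
      \<open>B\<close> is \<open>s\<close> times the first unit vector, orthogonality to it says
      that the rest of the first row of \<open>B\<close> is zero.\<close>
    have "adjoint_mat B * B = adjoint_mat M * M"
      using M unitary_matD(2,3)[OF U] by (simp add: B_def assoc_mult_mat_dim unitary_mat_cancel[OF U])
    then have BB: "(adjoint_mat B * B) $$ (j, 0) = 0" if "0 < j" "j < Suc n" for j
      using col0 that by (simp add: M_def)
    have Br: "B $$ (0, j) = 0" if j: "0 < j" "j < Suc n" for j
    proof -
      have "(adjoint_mat B * B) $$ (j, 0) = (\<Sum>k<m. cnj (B $$ (k, j)) * (if k = 0 then of_real s else 0))"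
        using B j by (subst index_mult_mat_sum) (auto simp: Bc)
      also have "\<dots> = (\<Sum>k<m. if k = 0 then cnj (B $$ (0, j)) * of_real s else 0)"
        by (intro sum.cong) auto
      finally have "cnj (B $$ (0, j)) * of_real s = 0" using BB[OF j] m by (simp add: sum_delta_lessThan)
      then show ?thesis using s by simp
    qed
    define A' where "A' = mat m' n (\<lambda>(i, j). B $$ (Suc i, Suc j))"
    have A': "A' \<in> carrier_mat m' n" by (simp add: A'_def)
    obtain r \<sigma> where r: "r \<le> m'" "r \<le> n" "\<forall>i<r. \<sigma> i > 0"
      and equiv: "unitarily_equivalent A' (singular_value_mat m' n r \<sigma>)"
      using Suc.IH[OF A'] by blast
    define \<sigma>' where "\<sigma>' = case_nat s \<sigma>"
    define L :: "complex mat" where "L = mat 1 1 (\<lambda>_. of_real s)"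
    have "B = block_diag L A'"
      using split_first[OF B[unfolded m']] Bc Br m by (simp add: A'_def L_def m')
    moreover have "singular_value_mat m (Suc n) (Suc r) \<sigma>' = block_diag L (singular_value_mat m' n r \<sigma>)"
      using r by (intro eq_matI)
        (auto simp: index_block_diag \<sigma>'_def L_def m' split: nat.split)
    moreover have "unitarily_equivalent (block_diag L A') (block_diag L (singular_value_mat m' n r \<sigma>))"
      by (rule unitarily_equivalent_block_diag[OF _ equiv]) simp
    moreover have "unitarily_equivalent A B"
      using unitarily_equivalent_conj[OF A U V] A unitary_matD(2,3)[OF U] unitary_matD(2,3)[OF V]
      by (simp add: B_def M_def assoc_mult_mat_dim)
    ultimately have "unitarily_equivalent A (singular_value_mat m (Suc n) (Suc r) \<sigma>')"
      by (metis unitarily_equivalent_trans)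
    moreover have "\<forall>i<Suc r. \<sigma>' i > 0" using r s by (auto simp: \<sigma>'_def split: nat.split)
    ultimately show ?thesis using r m' by (intro exI[of _ "Suc r"] exI[of _ \<sigma>']) auto
  qed
qed

section \<open>Dual matrices\<close>

lemma index_congruence_sum:
  fixes X W :: "complex mat"
  assumes "W \<in> carrier_mat n n" "X \<in> carrier_mat n n" "i < n" "j < n"
  shows "(adjoint_mat W * X * W) $$ (i, j) = (\<Sum>l<n. \<Sum>k<n. cnj (W $$ (k, i)) * X $$ (k, l) * W $$ (l, j))"
  using assms
  by (simp add: index_mult_mat_sum sum_distrib_right del: index_mult_mat(1))

text \<open>Only the part of \<open>Q\<close> that commutes with the diagonal matrix \<open>S\<close> of the \<open>\<sigma> i\<close> matters; call it
  \<open>Q\<^sub>1\<close>. Then \<open>S\<close> and \<open>Q\<^sub>1\<close> are diagonalized simultaneously by diagonalizing the normal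
  matrix \<open>S + i Q\<^sub>1\<close>.\<close>

lemma hermitian_refinement:
  fixes Q :: "complex mat" and \<sigma> :: "nat \<Rightarrow> real"
  assumes Q: "Q \<in> carrier_mat r r" and herm: "adjoint_mat Q = Q"
  obtains W \<tau> where "unitary_mat r W"
    "adjoint_mat W * singular_value_mat r r r \<sigma> * W = singular_value_mat r r r \<tau>"
    "\<And>i. i < r \<Longrightarrow> \<exists>k<r. \<tau> i = \<sigma> k"
    "\<And>i j. i < r \<Longrightarrow> j < r \<Longrightarrow> i \<noteq> j \<Longrightarrow> \<tau> i = \<tau> j \<Longrightarrow> (adjoint_mat W * Q * W) $$ (i, j) = 0"
proof -
  define S where "S = singular_value_mat r r r \<sigma>"
  have S: "S \<in> carrier_mat r r" by (simp add: S_def)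
  define Q1 where "Q1 = mat r r (\<lambda>(i, j). if \<sigma> i = \<sigma> j then Q $$ (i, j) else 0)"
  have Q1: "Q1 \<in> carrier_mat r r" by (simp add: Q1_def)
  have Qc: "cnj (Q $$ (j, i)) = Q $$ (i, j)" if "i < r" "j < r" for i j
    using arg_cong[OF herm, of "\<lambda>M. M $$ (i, j)"] Q that by simp
  have Q1c: "cnj (Q1 $$ (j, i)) = Q1 $$ (i, j)" if "i < r" "j < r" for i j
    using that Qc by (auto simp: Q1_def)
  define N where "N = mat r r (\<lambda>(i, j). S $$ (i, j) + \<i> * Q1 $$ (i, j))"
  have N: "N \<in> carrier_mat r r" by (simp add: N_def)
  have Nij: "N $$ (i, j) = S $$ (i, j) + \<i> * Q1 $$ (i, j)"
      "adjoint_mat N $$ (i, j) = S $$ (i, j) - \<i> * Q1 $$ (i, j)" if "i < r" "j < r" for i j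
    using that Q1c by (simp_all add: N_def S_def)
  \<comment> \<open>\<open>Q1\<close> is supported on index pairs with equal
    \<open>\<sigma>\<close>, so it commutes with \<open>S\<close>. This cancels the cross terms in
    which the products of \<open>N\<close> and its adjoint differ.\<close>
  have comm: "(\<Sum>k<r. S $$ (i, k) * Q1 $$ (k, j)) = (\<Sum>k<r. Q1 $$ (i, k) * S $$ (k, j))"
    if "i < r" "j < r" for i j
  proof -
    have "(\<Sum>k<r. S $$ (i, k) * Q1 $$ (k, j)) = (\<Sum>k<r. if k = i then of_real (\<sigma> i) * Q1 $$ (i, j) else 0)"
      using that by (intro sum.cong) (auto simp: S_def)
    moreover have "(\<Sum>k<r. Q1 $$ (i, k) * S $$ (k, j)) = (\<Sum>k<r. if k = j then of_real (\<sigma> j) * Q1 $$ (i, j) else 0)"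
      using that by (intro sum.cong) (auto simp: S_def)
    ultimately show ?thesis using that by (simp add: sum_delta_lessThan) (simp add: Q1_def)
  qed
  have "adjoint_mat N * N = N * adjoint_mat N"
  proof (rule eq_matI)
    fix i j assume "i < dim_row (N * adjoint_mat N)" "j < dim_col (N * adjoint_mat N)"
    then have ij: "i < r" "j < r" using N by auto
    have "(adjoint_mat N * N) $$ (i, j) = (\<Sum>k<r. (S $$ (i, k) - \<i> * Q1 $$ (i, k)) * (S $$ (k, j) + \<i> * Q1 $$ (k, j)))"
      using N ij by (subst index_mult_mat_sum) (auto simp: Nij simp del: index_adjoint_mat)
    also have "\<dots> = (\<Sum>k<r. S $$ (i, k) * S $$ (k, j) + Q1 $$ (i, k) * Q1 $$ (k, j))
        + \<i> * ((\<Sum>k<r. S $$ (i, k) * Q1 $$ (k, j)) - (\<Sum>k<r. Q1 $$ (i, k) * S $$ (k, j)))"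
      by (simp add: algebra_simps sum.distrib sum_subtractf sum_distrib_left)
    also have "\<dots> = (\<Sum>k<r. S $$ (i, k) * S $$ (k, j) + Q1 $$ (i, k) * Q1 $$ (k, j))
        - \<i> * ((\<Sum>k<r. S $$ (i, k) * Q1 $$ (k, j)) - (\<Sum>k<r. Q1 $$ (i, k) * S $$ (k, j)))"
      by (simp add: comm[OF ij])
    also have "\<dots> = (\<Sum>k<r. (S $$ (i, k) + \<i> * Q1 $$ (i, k)) * (S $$ (k, j) - \<i> * Q1 $$ (k, j)))"
      by (simp add: algebra_simps sum.distrib sum_subtractf sum_distrib_left)
    also have "\<dots> = (N * adjoint_mat N) $$ (i, j)"
      using N ij by (subst index_mult_mat_sum) (auto simp: Nij simp del: index_adjoint_mat)
    finally show "(adjoint_mat N * N) $$ (i, j) = (N * adjoint_mat N) $$ (i, j)" .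
  qed (use N in auto)
  then obtain W where W: "unitary_mat r W" and D: "diagonal_mat (adjoint_mat W * N * W)"
    using normal_mat_unitarily_diagonalizable[OF N] by blast
  note Wd = unitary_matD[OF W]
  define F where "F X = adjoint_mat W * X * W" for X
  have F_lin: "F N $$ (i, j) = F S $$ (i, j) + \<i> * F Q1 $$ (i, j)"
      "F (adjoint_mat N) $$ (i, j) = F S $$ (i, j) - \<i> * F Q1 $$ (i, j)" if "i < r" "j < r" for i j
    unfolding F_def using that N S Q1 Wd(1)
    by (simp_all add: index_congruence_sum Nij algebra_simps sum.distrib sum_subtractf sum_distrib_left
        del: index_adjoint_mat index_mult_mat(1))
  \<comment> \<open>Off the diagonal both \<open>F N\<close> and its adjoint vanish. These are
    \<open>F S\<close> plus and minus \<i> times \<open>F Q1\<close>, so both summands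
    vanish.\<close>
  have offdiag: "F S $$ (i, j) = 0" "F Q1 $$ (i, j) = 0" if ij: "i < r" "j < r" "i \<noteq> j" for i j
  proof -
    have 1: "F N $$ (i, j) = 0" "F N $$ (j, i) = 0"
      using D that Wd(2,3) by (auto simp: F_def diagonal_mat_def simp del: index_mult_mat(1))
    have "F (adjoint_mat N) = adjoint_mat (F N)"
      using N Wd(2,3) by (simp add: F_def assoc_mult_mat_dim)
    then have 2: "F (adjoint_mat N) $$ (i, j) = 0"
      using 1(2) ij Wd(2,3) by (simp add: F_def del: index_mult_mat(1))
    show "F S $$ (i, j) = 0" "F Q1 $$ (i, j) = 0"
      using 1(1) 2 F_lin[OF ij(1,2)] by auto
  qed
  define d where "d i = F S $$ (i, i)" for i
  \<comment> \<open>As \<open>F S\<close> is diagonal, column \<open>i\<close> of \<open>W\<close>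
    is an eigenvector of \<open>S\<close> for \<open>d i\<close>. Comparing entries gives
    \<open>d i = \<sigma> k\<close> wherever \<open>W $$ (k, i)\<close> is nonzero, and a column of
    a unitary matrix has such an entry.\<close>
  have SW: "of_real (\<sigma> k) * W $$ (k, i) = W $$ (k, i) * d i" if ki: "k < r" "i < r" for k i
  proof -
    have FS: "F S \<in> carrier_mat r r" using Wd(2,3) by (auto simp: F_def)
    have "S * W = W * F S"
      using S Wd(2,3) by (simp add: F_def assoc_mult_mat_dim unitary_mat_cancel[OF W])
    then have "(S * W) $$ (k, i) = (W * F S) $$ (k, i)" by simp
    also have "(S * W) $$ (k, i) = (\<Sum>l<r. S $$ (k, l) * W $$ (l, i))"
      using S Wd(1) ki by (subst index_mult_mat_sum) auto
    also have "\<dots> = (\<Sum>l<r. if l = k then of_real (\<sigma> k) * W $$ (k, i) else 0)"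
      using ki by (intro sum.cong) (auto simp: S_def)
    also have "(W * F S) $$ (k, i) = (\<Sum>l<r. W $$ (k, l) * F S $$ (l, i))"
      using FS Wd(1) ki by (subst index_mult_mat_sum) auto
    also have "\<dots> = (\<Sum>l<r. if l = i then W $$ (k, i) * d i else 0)"
      using ki by (intro sum.cong) (auto simp: d_def offdiag)
    finally show ?thesis using ki by (simp add: sum_delta_lessThan)
  qed
  have col_ne: "\<exists>k<r. W $$ (k, i) \<noteq> 0" if i: "i < r" for i
  proof (rule ccontr)
    assume "\<not> ?thesis"
    then have "(adjoint_mat W * W) $$ (i, i) = 0"
      using i Wd(1-3) by (subst index_mult_mat_sum) auto
    then show False using Wd(4) i by simp
  qed
  define \<tau> where "\<tau> i = Re (d i)" for i
  have d_eq: "d i = of_real (\<sigma> k)" if "i < r" "k < r" "W $$ (k, i) \<noteq> 0" for i k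
    using SW[OF that(2,1)] that(3) by (simp add: mult.commute)
  then have \<tau>_eq: "\<tau> i = \<sigma> k" if "i < r" "k < r" "W $$ (k, i) \<noteq> 0" for i k
    using that by (simp add: \<tau>_def)
  show thesis
  proof (rule that[OF W])
    show "adjoint_mat W * singular_value_mat r r r \<sigma> * W = singular_value_mat r r r \<tau>"
    proof (rule eq_matI)
      fix i j assume "i < dim_row (singular_value_mat r r r \<tau>)" "j < dim_col (singular_value_mat r r r \<tau>)"
      then have ij: "i < r" "j < r" by auto
      obtain k where "k < r" "W $$ (k, i) \<noteq> 0" using col_ne[OF ij(1)] by blast
      then have "d i = of_real (\<tau> i)" using d_eq ij \<tau>_eq by metis
      then show "(adjoint_mat W * singular_value_mat r r r \<sigma> * W) $$ (i, j) = singular_value_mat r r r \<tau> $$ (i, j)"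
        using ij offdiag(1)[OF ij] unfolding S_def[symmetric] F_def[of S, symmetric]
        by (cases "i = j") (simp_all add: d_def)
    qed (use Wd(2,3) in auto)
  next
    fix i assume "i < r"
    then show "\<exists>k<r. \<tau> i = \<sigma> k" using col_ne \<tau>_eq by metis
  next
    fix i j assume ij: "i < r" "j < r" "i \<noteq> j" and eq: "\<tau> i = \<tau> j"
    \<comment> \<open>If both outer factors are nonzero, then
      \<open>\<sigma> k = \<tau> i = \<tau> j = \<sigma> l\<close>, and there \<open>Q\<close> and
      \<open>Q1\<close> agree.\<close>
    have "cnj (W $$ (k, i)) * Q $$ (k, l) * W $$ (l, j) = cnj (W $$ (k, i)) * Q1 $$ (k, l) * W $$ (l, j)"
      if "k < r" "l < r" for k l
    proof (cases "W $$ (k, i) = 0 \<or> W $$ (l, j) = 0")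
      case False
      then have "\<sigma> k = \<sigma> l" using \<tau>_eq ij that eq by metis
      then show ?thesis using that by (simp add: Q1_def)
    qed auto
    then have "F Q $$ (i, j) = F Q1 $$ (i, j)"
      unfolding F_def index_congruence_sum[OF Wd(1) Q ij(1,2)] index_congruence_sum[OF Wd(1) Q1 ij(1,2)]
      by (intro sum.cong) simp_all
    then show "(adjoint_mat W * Q * W) $$ (i, j) = 0"
      using offdiag(2)[OF ij] by (simp add: F_def)
  qed
qed

section \<open>Dual matrices from standard and infinitesimal parts\<close>

definition dual_mat :: "complex mat \<Rightarrow> complex mat \<Rightarrow> dual_complex mat" where
  "dual_mat A K = mat (dim_row A) (dim_col A) (\<lambda>ij. Dual (A $$ ij) (K $$ ij))"

lemma dim_dual_mat [simp]: "dim_row (dual_mat A K) = dim_row A" "dim_col (dual_mat A K) = dim_col A"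
  by (simp_all add: dual_mat_def)

lemma dual_mat_carrier [simp]: "A \<in> carrier_mat m n \<Longrightarrow> dual_mat A K \<in> carrier_mat m n"
  by (intro carrier_matI) simp_all

lemma index_dual_mat [simp]:
  "i < dim_row A \<Longrightarrow> j < dim_col A \<Longrightarrow> dual_mat A K $$ (i, j) = Dual (A $$ (i, j)) (K $$ (i, j))"
  by (simp add: dual_mat_def)

lemma dual_mat_parts: "A = dual_mat (map_mat std_part A) (map_mat inf_part A)"
  by (rule eq_matI) auto

lemma dual_parts_arith [simp]:
  "std_part 0 = 0" "inf_part 0 = 0" "std_part 1 = 1" "inf_part 1 = 0"
  "std_part (x + y) = std_part x + std_part y" "inf_part (x + y) = inf_part x + inf_part y"
  "std_part (x * y) = std_part x * std_part y"
  "inf_part (x * y) = std_part x * inf_part y + inf_part x * std_part y"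
  "std_part (conjugate x) = cnj (std_part x)" "inf_part (conjugate x) = cnj (inf_part x)"
  "std_part (x - y) = std_part x - std_part y" "inf_part (x - y) = inf_part x - inf_part y"
  by (simp_all add: zero_dual_complex_def one_dual_complex_def plus_dual_complex_def
      times_dual_complex_def conjugate_dual_complex_def minus_dual_complex_def)

lemma std_part_sum: "std_part (sum f I) = (\<Sum>i\<in>I. std_part (f i))"
  by (induction I rule: infinite_finite_induct) auto

lemma inf_part_sum: "inf_part (sum f I) = (\<Sum>i\<in>I. inf_part (f i))"
  by (induction I rule: infinite_finite_induct) auto

lemma dual_mat_mult:
  assumes "A \<in> carrier_mat m k" "K \<in> carrier_mat m k" "B \<in> carrier_mat k n" "L \<in> carrier_mat k n"
  shows "dual_mat A K * dual_mat B L = dual_mat (A * B) (A * L + K * B)"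
proof (rule eq_matI)
  fix i j assume "i < dim_row (dual_mat (A * B) (A * L + K * B))" "j < dim_col (dual_mat (A * B) (A * L + K * B))"
  with assms show "(dual_mat A K * dual_mat B L) $$ (i, j) = dual_mat (A * B) (A * L + K * B) $$ (i, j)"
    by (intro dual_complex.expand)
      (simp add: index_mult_mat_sum std_part_sum inf_part_sum sum.distrib del: index_mult_mat(1))
qed (use assms in auto)

lemma adjoint_dual_mat:
  assumes "A \<in> carrier_mat m n" "K \<in> carrier_mat m n"
  shows "adjoint_mat (dual_mat A K) = dual_mat (adjoint_mat A) (adjoint_mat K)"
  using assms by (intro eq_matI) (auto simp: conjugate_dual_complex_def)

lemma dual_mat_one: "dual_mat (1\<^sub>m n) (0\<^sub>m n n) = 1\<^sub>m n"
  by (rule eq_matI) (auto intro: dual_complex.expand)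

lemma unitary_dual_mat_std:
  assumes "unitary_mat n U"
  shows "unitary_mat n (dual_mat U (0\<^sub>m n n))"
  using unitary_matD[OF assms]
  by (simp add: unitary_mat_def adjoint_dual_mat[of U n n] dual_mat_mult[of _ n n _ _ n] dual_mat_one)

text \<open>Since \<epsilon> squares to zero, (1 + S \<epsilon>)*(1 + S \<epsilon>) is 1 + (S* + S)
  \<epsilon>, and the \<epsilon>-term vanishes for skew-Hermitian \<open>S\<close>.\<close>

lemma unitary_dual_mat_inf:
  assumes S: "S \<in> carrier_mat n n" and skew: "adjoint_mat S = - S"
  shows "unitary_mat n (dual_mat (1\<^sub>m n) S)"
proof -
  have "S + - S = 0\<^sub>m n n" "- S + S = 0\<^sub>m n n" using S by auto
  then show ?thesis
    using S skew
    by (simp add: unitary_mat_def adjoint_dual_mat[of _ n n] dual_mat_mult[of _ n n _ _ n] dual_mat_one)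
qed

text \<open>Complex unitaries act on the standard and the infinitesimal part separately, so
  simplifying the former costs only a change of basis in the latter.\<close>

lemma unitarily_equivalent_dual_mat:
  assumes B: "B \<in> carrier_mat m n" and K: "K \<in> carrier_mat m n"
    and U: "unitary_mat m U" and V: "unitary_mat n V"
  shows "unitarily_equivalent (dual_mat (U * B * adjoint_mat V) K) (dual_mat B (adjoint_mat U * K * V))"
proof (rule unitarily_equivalentI[OF dual_mat_carrier[OF B] unitary_dual_mat_std[OF U] unitary_dual_mat_std[OF V]])
  have "adjoint_mat (dual_mat V (0\<^sub>m n n)) = dual_mat (adjoint_mat V) (0\<^sub>m n n)"
    using unitary_matD(1)[OF V] by (simp add: adjoint_dual_mat)
  moreover have "dual_mat U (0\<^sub>m m m) * dual_mat B (adjoint_mat U * K * V) = dual_mat (U * B) (K * V)"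
    using unitary_matD(1-3)[OF U] unitary_matD(1-3)[OF V] B K
    by (subst dual_mat_mult[of U m m _ B n])
      (auto simp: assoc_mult_mat_dim unitary_mat_cancel[OF U])
  moreover have "dual_mat (U * B) (K * V) * dual_mat (adjoint_mat V) (0\<^sub>m n n) = dual_mat (U * B * adjoint_mat V) K"
    using unitary_matD[OF U] unitary_matD[OF V] B K
    by (subst dual_mat_mult[of _ m n _ _ n]) (auto simp: assoc_mult_mat_dim)
  ultimately show "dual_mat (U * B * adjoint_mat V) K =
      dual_mat U (0\<^sub>m m m) * dual_mat B (adjoint_mat U * K * V) * adjoint_mat (dual_mat V (0\<^sub>m n n))"
    by simp
qed

section \<open>The dual singular value decomposition\<close>

text \<open>The left and right unitaries share the upper block \<open>W\<close>, which keeps the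
  standard part diagonal while diagonalizing the Hermitian part of \<open>K\<close> within each
  group of equal singular values. The lower blocks come from an SVD of the lower right block of
  \<open>K\<close> and can be chosen freely, because the standard part is zero there.\<close>

lemma dual_mat_block_reduction:
  assumes K: "K \<in> carrier_mat m n" and r: "r \<le> m" "r \<le> n" and \<sigma>: "\<And>i. i < r \<Longrightarrow> \<sigma> i > 0"
  obtains \<tau> K' where "K' \<in> carrier_mat m n" "\<And>i. i < r \<Longrightarrow> \<tau> i > 0"
    "unitarily_equivalent (dual_mat (singular_value_mat m n r \<sigma>) K) (dual_mat (singular_value_mat m n r \<tau>) K')"
    "\<And>i j. i < r \<Longrightarrow> j < r \<Longrightarrow> i \<noteq> j \<Longrightarrow> \<tau> i = \<tau> j \<Longrightarrow> K' $$ (i, j) + cnj (K' $$ (j, i)) = 0"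
    "\<And>i j. r \<le> i \<Longrightarrow> i < m \<Longrightarrow> r \<le> j \<Longrightarrow> j < n \<Longrightarrow> i \<noteq> j \<Longrightarrow> K' $$ (i, j) = 0"
    "\<And>i. r \<le> i \<Longrightarrow> i < m \<Longrightarrow> i < n \<Longrightarrow> \<exists>x\<ge>0. K' $$ (i, i) = complex_of_real x"
proof -
  define K11 where "K11 = mat r r (\<lambda>(i, j). K $$ (i, j))"
  define K12 where "K12 = mat r (n - r) (\<lambda>(i, j). K $$ (i, j + r))"
  define K21 where "K21 = mat (m - r) r (\<lambda>(i, j). K $$ (i + r, j))"
  define K22 where "K22 = mat (m - r) (n - r) (\<lambda>(i, j). K $$ (i + r, j + r))"
  have c: "K11 \<in> carrier_mat r r" "K12 \<in> carrier_mat r (n - r)" "K21 \<in> carrier_mat (m - r) r"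
      "K22 \<in> carrier_mat (m - r) (n - r)"
    by (simp_all add: K11_def K12_def K21_def K22_def)
  have K_eq: "K = four_block_mat K11 K12 K21 K22"
    using K r by (intro eq_matI) (auto simp: K11_def K12_def K21_def K22_def)
  \<comment> \<open>Twice the Hermitian part of the upper left block. Its skew-Hermitian part is
    left for the later step with unitaries 1 + S \<epsilon>.\<close>
  define Q where "Q = K11 + adjoint_mat K11"
  have Q: "Q \<in> carrier_mat r r" using c by (auto simp: Q_def)
  have herm: "adjoint_mat Q = Q"
    using c by (intro eq_matI) (auto simp: Q_def)
  obtain W \<tau> where W: "unitary_mat r W"
    and W\<tau>: "adjoint_mat W * singular_value_mat r r r \<sigma> * W = singular_value_mat r r r \<tau>"
    and \<tau>: "\<And>i. i < r \<Longrightarrow> \<exists>k<r. \<tau> i = \<sigma> k"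
    and WQ: "\<And>i j. i < r \<Longrightarrow> j < r \<Longrightarrow> i \<noteq> j \<Longrightarrow> \<tau> i = \<tau> j \<Longrightarrow> (adjoint_mat W * Q * W) $$ (i, j) = 0"
    using hermitian_refinement[OF Q herm, where \<sigma> = \<sigma>] by blast
  note Wd = unitary_matD[OF W]
  obtain r2 \<rho> where \<rho>: "\<forall>i<r2. \<rho> i > 0"
    and equiv: "unitarily_equivalent K22 (singular_value_mat (m - r) (n - r) r2 \<rho>)"
    using complex_svd[OF c(4)] by blast
  define D2 where "D2 = singular_value_mat (m - r) (n - r) r2 \<rho>"
  obtain U2 V2 where U2: "unitary_mat (m - r) U2" and V2: "unitary_mat (n - r) V2"
    and K22: "K22 = U2 * D2 * adjoint_mat V2"
    using unitarily_equivalentE[OF equiv singular_value_mat_carrier] unfolding D2_def by blast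
  have D2: "D2 \<in> carrier_mat (m - r) (n - r)" by (simp add: D2_def)
  have D2_eq: "adjoint_mat U2 * K22 * V2 = D2"
    using D2 unitary_matD[OF U2] unitary_matD[OF V2]
    by (simp add: K22 assoc_mult_mat_dim unitary_mat_cancel[OF U2])
  define U where "U = block_diag W U2"
  define V where "V = block_diag W V2"
  have U: "unitary_mat m U" using unitary_block_diag[OF W U2] r by (simp add: U_def)
  have V: "unitary_mat n V" using unitary_block_diag[OF W V2] r by (simp add: V_def)
  define K' where "K' = adjoint_mat U * K * V"
  have K'_eq: "K' = four_block_mat (adjoint_mat W * K11 * W) (adjoint_mat W * K12 * V2)
      (adjoint_mat U2 * K21 * W) D2"
  proof -
    have "adjoint_mat U * K = four_block_mat (adjoint_mat W * K11) (adjoint_mat W * K12)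
        (adjoint_mat U2 * K21) (adjoint_mat U2 * K22)"
      unfolding K_eq U_def adjoint_block_diag
      using c unitary_matD(1)[OF W] unitary_matD(1)[OF U2]
      by (intro block_diag_mult_four_block_mat) auto
    moreover have "four_block_mat (adjoint_mat W * K11) (adjoint_mat W * K12)
        (adjoint_mat U2 * K21) (adjoint_mat U2 * K22) * V = four_block_mat (adjoint_mat W * K11 * W)
        (adjoint_mat W * K12 * V2) (adjoint_mat U2 * K21 * W) (adjoint_mat U2 * K22 * V2)"
      unfolding V_def
      by (rule four_block_mat_mult_block_diag[of _ r r _ "n - r" _ "m - r"])
        (use c unitary_matD(1)[OF W] unitary_matD(1)[OF U2] unitary_matD(1)[OF V2] in auto)
    ultimately show ?thesis by (simp add: K'_def D2_eq)
  qed
  have K': "K' \<in> carrier_mat m n"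
    using K unitary_matD(1)[OF U] unitary_matD(1)[OF V] by (auto simp: K'_def)
  have svm: "singular_value_mat m n r \<theta> = block_diag (singular_value_mat r r r \<theta>) (0\<^sub>m (m - r) (n - r))" for \<theta>
    using r by (intro eq_matI) (auto simp: index_block_diag)
  have D_eq: "adjoint_mat U * singular_value_mat m n r \<sigma> * V = singular_value_mat m n r \<tau>"
    using Wd(2,3) unitary_matD(1-3)[OF U2] unitary_matD(1-3)[OF V2]
    by (simp add: U_def V_def svm W\<tau>)
  have "U * singular_value_mat m n r \<tau> * adjoint_mat V = singular_value_mat m n r \<sigma>"
    unfolding D_eq[symmetric] using unitary_matD[OF U] unitary_matD[OF V]
    by (simp add: assoc_mult_mat_dim unitary_mat_cancel[OF U])
  then have 3: "unitarily_equivalent (dual_mat (singular_value_mat m n r \<sigma>) K)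
      (dual_mat (singular_value_mat m n r \<tau>) K')"
    using unitarily_equivalent_dual_mat[OF singular_value_mat_carrier[of m n r \<tau>] K U V]
    by (simp add: K'_def)
  have 4: "K' $$ (i, j) + cnj (K' $$ (j, i)) = 0" if "i < r" "j < r" "i \<noteq> j" "\<tau> i = \<tau> j" for i j
  proof -
    have WK: "adjoint_mat W * K11 * W \<in> carrier_mat r r" using c Wd(1) by auto
    have "adjoint_mat W * Q * W = adjoint_mat W * K11 * W + adjoint_mat W * adjoint_mat K11 * W"
      unfolding Q_def using c Wd(1)
      by (subst mult_add_distrib_mat[of _ r r _ r], simp_all)
        (subst add_mult_distrib_mat[of _ r r _ _ r], auto)
    also have "adjoint_mat W * adjoint_mat K11 * W = adjoint_mat (adjoint_mat W * K11 * W)"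
      using c Wd(2,3) by (simp add: assoc_mult_mat_dim)
    finally have "(adjoint_mat W * K11 * W) $$ (i, j) + cnj ((adjoint_mat W * K11 * W) $$ (j, i)) = 0"
      using WQ[OF that] WK that Wd(2,3) by (simp del: index_mult_mat(1) adjoint_mat_mult)
    then show ?thesis
      using that r D2 Wd(2,3) by (simp add: K'_eq del: index_mult_mat(1))
  qed
  have 5: "K' $$ (i, j) = D2 $$ (i - r, j - r)" if "r \<le> i" "i < m" "r \<le> j" "j < n" for i j
    using that D2 Wd(2,3) by (simp add: K'_eq del: index_mult_mat(1))
  show thesis
  proof (rule that[OF K' _ 3 4])
    show "\<tau> i > 0" if "i < r" for i using \<tau>[OF that] \<sigma> by auto
    show "K' $$ (i, j) = 0" if "r \<le> i" "i < m" "r \<le> j" "j < n" "i \<noteq> j" for i j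
      using 5[of i j] that by (auto simp: D2_def)
    show "\<exists>x\<ge>0. K' $$ (i, i) = complex_of_real x" if "r \<le> i" "i < m" "i < n" for i
      using 5[of i i] that \<rho>
      \<comment> \<open>The diagonal of \<open>D2\<close> is zero beyond the rank \<open>r2\<close>,
        hence the default 0.\<close>
      by (intro exI[of _ "if i - r < r2 then \<rho> (i - r) else 0"]) (auto simp: D2_def intro: less_imp_le)
  qed
qed

text \<open>Conjugating with \<open>1 + S \<epsilon>\<close> and \<open>1 + T \<epsilon>\<close> for skew-Hermitian \<open>S\<close>, \<open>T\<close> replaces \<open>K\<close> by
  \<open>K - S D + D T\<close>. The choices below solve, for every pair \<open>i \<noteq> j\<close>, the two linear equations
  that make both off-diagonal entries of the result vanish; for \<open>i, j < r\<close> their determinant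
  is \<open>\<sigma>\<^sub>j\<^sup>2 - \<sigma>\<^sub>i\<^sup>2\<close>.\<close>

lemma dual_mat_diagonal_reduction:
  assumes K: "K \<in> carrier_mat m n" and r: "r \<le> m" "r \<le> n" and \<sigma>: "\<And>i. i < r \<Longrightarrow> \<sigma> i > 0"
    and deg: "\<And>i j. i < r \<Longrightarrow> j < r \<Longrightarrow> i \<noteq> j \<Longrightarrow> \<sigma> i = \<sigma> j \<Longrightarrow> K $$ (i, j) + cnj (K $$ (j, i)) = 0"
    and lower: "\<And>i j. r \<le> i \<Longrightarrow> i < m \<Longrightarrow> r \<le> j \<Longrightarrow> j < n \<Longrightarrow> i \<noteq> j \<Longrightarrow> K $$ (i, j) = 0"
  obtains L where "L \<in> carrier_mat m n"
    "unitarily_equivalent (dual_mat (singular_value_mat m n r \<sigma>) K) (dual_mat (singular_value_mat m n r \<sigma>) L)"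
    "\<And>i j. i < m \<Longrightarrow> j < n \<Longrightarrow> i \<noteq> j \<Longrightarrow> L $$ (i, j) = 0"
    "\<And>i. i < r \<Longrightarrow> L $$ (i, i) \<in> \<real>"
    "\<And>i. r \<le> i \<Longrightarrow> i < m \<Longrightarrow> i < n \<Longrightarrow> L $$ (i, i) = K $$ (i, i)"
proof -
  define \<kappa> where "\<kappa> i j = K $$ (i, j)" for i j
  \<comment> \<open>On the diagonal \<open>s\<close> removes the imaginary part of \<open>K\<close>.
    For equal values the block of \<open>K\<close> is already skew off the diagonal, so
    \<open>s\<close> alone cancels it. In the lower left block \<open>s\<close> does the cancelling,
    in the upper right block \<open>t\<close>; the values in the mirrored positions are dictated by
    skewness.\<close>
  define s where "s i j =
    (if i < r then
       if j < r then
         if i = j then \<i> * of_real (Im (\<kappa> i i) / \<sigma> i)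
         else if \<sigma> i = \<sigma> j then \<kappa> i j / of_real (\<sigma> i)
         else (of_real (\<sigma> j) * \<kappa> i j + of_real (\<sigma> i) * cnj (\<kappa> j i)) / of_real ((\<sigma> j)\<^sup>2 - (\<sigma> i)\<^sup>2)
       else - cnj (\<kappa> j i) / of_real (\<sigma> i)
     else if j < r then \<kappa> i j / of_real (\<sigma> j) else 0)" for i j
  define t where "t i j =
    (if i < r then
       if j < r then
         if i = j \<or> \<sigma> i = \<sigma> j then 0
         else (of_real (\<sigma> i) * \<kappa> i j + of_real (\<sigma> j) * cnj (\<kappa> j i)) / of_real ((\<sigma> j)\<^sup>2 - (\<sigma> i)\<^sup>2)
       else - \<kappa> i j / of_real (\<sigma> i)
     else if j < r then cnj (\<kappa> j i) / of_real (\<sigma> j) else 0)" for i j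
  have sq: "(\<sigma> j)\<^sup>2 - (\<sigma> i)\<^sup>2 \<noteq> 0" if "i < r" "j < r" "\<sigma> i \<noteq> \<sigma> j" for i j
    using that \<sigma>[of i] \<sigma>[of j] by (simp add: power2_eq_iff_nonneg)
  \<comment> \<open>Exchanging the indices flips the sign of the denominator, whereas exchanging and
    conjugating leaves the numerators of \<open>s\<close> and \<open>t\<close> unchanged; this gives
    skewness.\<close>
  have minus_sq: "complex_of_real ((\<sigma> i)\<^sup>2 - (\<sigma> j)\<^sup>2) = - complex_of_real ((\<sigma> j)\<^sup>2 - (\<sigma> i)\<^sup>2)" for i j
    by simp
  have deg': "cnj (\<kappa> j i) = - \<kappa> i j" if "i < r" "j < r" "i \<noteq> j" "\<sigma> i = \<sigma> j" for i j
    using deg[OF that] by (simp add: \<kappa>_def eq_neg_iff_add_eq_0 add.commute)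
  have s_skew: "cnj (s j i) = - s i j" for i j
  proof (cases "i < r \<and> j < r \<and> i \<noteq> j")
    case True
    show ?thesis
    proof (cases "\<sigma> i = \<sigma> j")
      case eq: True
      then show ?thesis using True deg'[of i j] by (simp add: s_def)
    next
      case False
      then show ?thesis using True
        by (simp add: s_def minus_sq[of i j] add.commute del: of_real_diff minus_diff_eq)
    qed
  qed (auto simp: s_def)
  have t_skew: "cnj (t j i) = - t i j" for i j
  proof (cases "i < r \<and> j < r \<and> \<sigma> i \<noteq> \<sigma> j")
    case True
    then show ?thesis
      by (auto simp: t_def minus_sq[of i j] add.commute simp del: of_real_diff minus_diff_eq)
  qed (auto simp: t_def)
  define S where "S = mat m m (\<lambda>(i, j). s i j)"
  define T where "T = mat n n (\<lambda>(i, j). t i j)"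
  have S: "S \<in> carrier_mat m m" and T: "T \<in> carrier_mat n n" by (simp_all add: S_def T_def)
  have S_skew: "adjoint_mat S = - S" using s_skew by (intro eq_matI) (auto simp: S_def)
  have T_skew: "adjoint_mat T = - T" using t_skew by (intro eq_matI) (auto simp: T_def)
  define D where "D = singular_value_mat m n r \<sigma>"
  have D: "D \<in> carrier_mat m n" by (simp add: D_def)
  have SD: "(S * D) $$ (i, j) = (if j < r then s i j * of_real (\<sigma> j) else 0)" if "i < m" "j < n" for i j
  proof -
    have "(S * D) $$ (i, j) = (\<Sum>k<m. S $$ (i, k) * D $$ (k, j))"
      using S D that by (subst index_mult_mat_sum) auto
    also have "\<dots> = (\<Sum>k<m. if k = j then (if j < r then s i j * of_real (\<sigma> j) else 0) else 0)"
      using that by (intro sum.cong) (auto simp: S_def D_def)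
    also have "\<dots> = (if j < r then s i j * of_real (\<sigma> j) else 0)"
      using r by auto
    finally show ?thesis .
  qed
  have DT: "(D * T) $$ (i, j) = (if i < r then of_real (\<sigma> i) * t i j else 0)" if "i < m" "j < n" for i j
  proof -
    have "(D * T) $$ (i, j) = (\<Sum>k<n. D $$ (i, k) * T $$ (k, j))"
      using T D that by (subst index_mult_mat_sum) auto
    also have "\<dots> = (\<Sum>k<n. if k = i then (if i < r then of_real (\<sigma> i) * t i j else 0) else 0)"
      using that by (intro sum.cong) (auto simp: T_def D_def)
    also have "\<dots> = (if i < r then of_real (\<sigma> i) * t i j else 0)"
      using r by auto
    finally show ?thesis .
  qed
  define L where "L = K - S * D + D * T"
  have L: "L \<in> carrier_mat m n" using K S D T by (auto simp: L_def)
  have Lij: "L $$ (i, j) = \<kappa> i j - (if j < r then s i j * of_real (\<sigma> j) else 0)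
      + (if i < r then of_real (\<sigma> i) * t i j else 0)" if "i < m" "j < n" for i j
    using that K S D T by (simp add: L_def SD DT \<kappa>_def del: index_mult_mat(1))
  have equiv: "unitarily_equivalent (dual_mat D K) (dual_mat D L)"
  proof (rule unitarily_equivalentI[OF dual_mat_carrier[OF D] unitary_dual_mat_inf[OF S S_skew]
        unitary_dual_mat_inf[OF T T_skew]])
    have "dual_mat (1\<^sub>m m) S * dual_mat D L = dual_mat D (L + S * D)"
      using S D L by (simp add: dual_mat_mult[of _ m m _ _ n])
    moreover have "dual_mat D (L + S * D) * adjoint_mat (dual_mat (1\<^sub>m n) T) = dual_mat D K"
    proof -
      have "adjoint_mat (dual_mat (1\<^sub>m n) T) = dual_mat (1\<^sub>m n) (- T)"
        using T T_skew by (simp add: adjoint_dual_mat[of _ n n])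
      moreover have "D * (- T) + (L + S * D) = K"
        using K S D T by (intro eq_matI) (auto simp: L_def simp del: index_mult_mat(1))
      ultimately show ?thesis
        using S D L T by (simp add: dual_mat_mult[of _ m n _ _ n])
    qed
    ultimately show "dual_mat D K = dual_mat (1\<^sub>m m) S * dual_mat D L * adjoint_mat (dual_mat (1\<^sub>m n) T)"
      by simp
  qed
  show thesis
  proof (rule that[OF L equiv[unfolded D_def]])
    fix i j assume ij: "i < m" "j < n" "i \<noteq> j"
    show "L $$ (i, j) = 0"
    proof (cases "i < r \<and> j < r \<and> \<sigma> i \<noteq> \<sigma> j")
      case True
      define d where "d = complex_of_real ((\<sigma> j)\<^sup>2 - (\<sigma> i)\<^sup>2)"
      have d: "d \<noteq> 0" using sq[of i j] True by (simp only: d_def of_real_eq_0_iff) simp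
      have d': "d = of_real (\<sigma> j) * of_real (\<sigma> j) - of_real (\<sigma> i) * of_real (\<sigma> i)"
        by (simp add: d_def power2_eq_square)
      have "s i j = (of_real (\<sigma> j) * \<kappa> i j + of_real (\<sigma> i) * cnj (\<kappa> j i)) / d"
        "t i j = (of_real (\<sigma> i) * \<kappa> i j + of_real (\<sigma> j) * cnj (\<kappa> j i)) / d"
        using True ij unfolding s_def t_def d_def by auto
      \<comment> \<open>Cramer's rule as a polynomial identity: \<open>x\<close> and
        \<open>y\<close> stand for \<open>\<sigma> i\<close> and \<open>\<sigma> j\<close>,
        \<open>k\<close> and \<open>l\<close> for \<open>\<kappa> i j\<close> and
        \<open>cnj (\<kappa> j i)\<close>.\<close>
      moreover have "k - (y * k + x * l) / d * y + x * ((x * k + y * l) / d) = 0"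
        if "d = y * y - x * x" for x y k l
      proof -
        have "k - (y * k + x * l) / d * y + x * ((x * k + y * l) / d)
            = (k * d - (y * k + x * l) * y + x * (x * k + y * l)) / d"
          using d by (simp add: add_divide_distrib diff_divide_distrib algebra_simps)
        also have "\<dots> = 0" unfolding that by (simp add: algebra_simps)
        finally show ?thesis .
      qed
      from this[OF d'] have "\<kappa> i j - (of_real (\<sigma> j) * \<kappa> i j + of_real (\<sigma> i) * cnj (\<kappa> j i)) / d * of_real (\<sigma> j)
          + of_real (\<sigma> i) * ((of_real (\<sigma> i) * \<kappa> i j + of_real (\<sigma> j) * cnj (\<kappa> j i)) / d) = 0" .
      ultimately show ?thesis using True ij by (simp only: Lij if_True)
    next
      case False
      then show ?thesis
        using ij \<sigma>[of i] \<sigma>[of j] lower[of i j] by (auto simp: Lij s_def t_def \<kappa>_def not_less)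
    qed
  next
    fix i assume "i < r"
    then show "L $$ (i, i) \<in> \<real>"
      using r \<sigma>[of i] by (simp add: Lij s_def t_def complex_is_Real_iff)
  next
    fix i assume "r \<le> i" "i < m" "i < n"
    then show "L $$ (i, i) = K $$ (i, i)" by (simp add: Lij \<kappa>_def)
  qed
qed

text \<open>Three unitary equivalences are chained: the SVD of the standard part, the block
  reduction, and the removal of the off-diagonal entries. The last one keeps the diagonal entries
  from \<open>r\<close> on, so they stay nonnegative multiples of \<epsilon>.\<close>

theorem dual_svd_exists:
  fixes A :: "dual_complex mat"
  obtains r U S1 S2 V where "is_svd A r U S1 S2 V"
proof -
  define m n where "m = dim_row A" and "n = dim_col A"
  define As Ad where "As = map_mat std_part A" and "Ad = map_mat inf_part A"
  have As: "As \<in> carrier_mat m n" and Ad: "Ad \<in> carrier_mat m n"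
    unfolding As_def Ad_def m_def n_def by (rule carrier_matI; simp)+
  obtain r \<sigma>0 where r: "r \<le> m" "r \<le> n" and \<sigma>0: "\<forall>i<r. \<sigma>0 i > 0"
    and eq: "unitarily_equivalent As (singular_value_mat m n r \<sigma>0)"
    using complex_svd[OF As] by blast
  obtain U0 V0 where U0: "unitary_mat m U0" and V0: "unitary_mat n V0"
    and As_eq: "As = U0 * singular_value_mat m n r \<sigma>0 * adjoint_mat V0"
    using unitarily_equivalentE[OF eq singular_value_mat_carrier] by blast
  define K0 where "K0 = adjoint_mat U0 * Ad * V0"
  have K0: "K0 \<in> carrier_mat m n"
    using Ad unitary_matD(1)[OF U0] unitary_matD(1)[OF V0] by (auto simp: K0_def)
  have A_eq: "A = dual_mat As Ad" unfolding As_def Ad_def by (rule dual_mat_parts)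
  have 1: "unitarily_equivalent A (dual_mat (singular_value_mat m n r \<sigma>0) K0)"
    using unitarily_equivalent_dual_mat[OF singular_value_mat_carrier[of m n r \<sigma>0] Ad U0 V0]
    unfolding As_eq[symmetric] K0_def[symmetric] A_eq[symmetric] .
  obtain \<sigma> K where K: "K \<in> carrier_mat m n" and \<sigma>: "\<And>i. i < r \<Longrightarrow> \<sigma> i > 0"
    and 2: "unitarily_equivalent (dual_mat (singular_value_mat m n r \<sigma>0) K0) (dual_mat (singular_value_mat m n r \<sigma>) K)"
    and deg: "\<And>i j. i < r \<Longrightarrow> j < r \<Longrightarrow> i \<noteq> j \<Longrightarrow> \<sigma> i = \<sigma> j \<Longrightarrow> K $$ (i, j) + cnj (K $$ (j, i)) = 0"
    and lower: "\<And>i j. r \<le> i \<Longrightarrow> i < m \<Longrightarrow> r \<le> j \<Longrightarrow> j < n \<Longrightarrow> i \<noteq> j \<Longrightarrow> K $$ (i, j) = 0"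
    and nonneg: "\<And>i. r \<le> i \<Longrightarrow> i < m \<Longrightarrow> i < n \<Longrightarrow> \<exists>x\<ge>0. K $$ (i, i) = complex_of_real x"
  proof (rule dual_mat_block_reduction[OF K0 r, of \<sigma>0])
    show "\<sigma>0 i > 0" if "i < r" for i using that \<sigma>0 by blast
  qed (rule that)
  obtain L where L: "L \<in> carrier_mat m n"
    and 3: "unitarily_equivalent (dual_mat (singular_value_mat m n r \<sigma>) K) (dual_mat (singular_value_mat m n r \<sigma>) L)"
    and off: "\<And>i j. i < m \<Longrightarrow> j < n \<Longrightarrow> i \<noteq> j \<Longrightarrow> L $$ (i, j) = 0"
    and real: "\<And>i. i < r \<Longrightarrow> L $$ (i, i) \<in> \<real>"
    and same: "\<And>i. r \<le> i \<Longrightarrow> i < m \<Longrightarrow> i < n \<Longrightarrow> L $$ (i, i) = K $$ (i, i)"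
  proof (rule dual_mat_diagonal_reduction[OF K r, of \<sigma>])
    show "\<sigma> i > 0" if "i < r" for i by (rule \<sigma>[OF that])
    show "K $$ (i, j) + cnj (K $$ (j, i)) = 0" if "i < r" "j < r" "i \<noteq> j" "\<sigma> i = \<sigma> j" for i j
      by (rule deg[OF that])
    show "K $$ (i, j) = 0" if "r \<le> i" "i < m" "r \<le> j" "j < n" "i \<noteq> j" for i j
      by (rule lower[OF that])
  qed (rule that)
  define M where "M = dual_mat (singular_value_mat m n r \<sigma>) L"
  have M: "M \<in> carrier_mat m n" by (simp add: M_def)
  have Mij: "M $$ (i, j) = Dual (if i = j \<and> i < r then of_real (\<sigma> i) else 0) (L $$ (i, j))"
    if "i < m" "j < n" for i j
    using that by (simp add: M_def)
  have M_off: "M $$ (i, j) = 0" if "i < m" "j < n" "i \<noteq> j" for i j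
    using that off by (simp add: Mij zero_dual_complex_def)
  have "unitarily_equivalent A M"
    using 1 2 3 unfolding M_def by (blast intro: unitarily_equivalent_trans)
  then obtain U V where U: "unitary_mat m U" and V: "unitary_mat n V" and A: "A = U * M * adjoint_mat V"
    using M by (rule unitarily_equivalentE)
  define S1 where "S1 = mat r r (\<lambda>(i, j). M $$ (i, j))"
  define S2 where "S2 = mat (m - r) (n - r) (\<lambda>(i, j). M $$ (i + r, j + r))"
  have M_eq: "M = four_block_mat S1 (0\<^sub>m r (n - r)) (0\<^sub>m (m - r) r) S2"
    using M r M_off by (intro eq_matI) (auto simp: S1_def S2_def)
  have "is_svd A r U S1 S2 V"
    unfolding is_svd_def Let_def m_def[symmetric] n_def[symmetric] unitary_dual_eq conj_transpose_eq_adjoint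
  proof (intro conjI allI impI)
    show "A = U * four_block_mat S1 (0\<^sub>m r (n - r)) (0\<^sub>m (m - r) r) S2 * adjoint_mat V"
      unfolding M_eq[symmetric] by (rule A)
    show "diagonal_mat S1" "diagonal_mat S2"
      using r by (auto simp: S1_def S2_def diagonal_mat_def M_off)
  next
    fix i assume "i < r"
    then show "positive_appreciable (S1 $$ (i, i))"
      using r real \<sigma> by (simp add: S1_def Mij positive_appreciable_def is_dual_number_def)
  next
    fix i assume i: "i < min (m - r) (n - r)"
    then have ir: "i + r < m" "i + r < n" by auto
    obtain x where "x \<ge> 0" "L $$ (i + r, i + r) = complex_of_real x"
      using same[OF le_add2 ir] nonneg[OF le_add2 ir] by metis
    then show "positive_infinitesimal (S2 $$ (i, i)) \<or> S2 $$ (i, i) = 0"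
      using i by (cases "x = 0")
        (auto simp: S2_def Mij positive_infinitesimal_def is_dual_number_def zero_dual_complex_def)
  qed (use r U V in \<open>simp_all add: S1_def S2_def\<close>)
  then show thesis by (rule that)
qed

section \<open>Essential part and Moore-Penrose inverse\<close>

text \<open>The usual equations A X A = A and A Y A = A are weakened to the absorption rules in
  \<open>XY\<close>, so that the argument also covers dual matrices for which A X A differs from A.
  Taking adjoints of products of projections gives A X = A Y and X A = Y A, and then X = X A X = X A
  Y = Y A Y = Y.\<close>

lemma penrose_unique:
  fixes A X Y :: "'a :: {conjugatable_ring, comm_ring_1} mat"
  assumes c: "A \<in> carrier_mat m n" "X \<in> carrier_mat n m" "Y \<in> carrier_mat n m"
    and X: "X * A * X = X" "adjoint_mat (A * X) = A * X" "adjoint_mat (X * A) = X * A"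
    and Y: "Y * A * Y = Y" "adjoint_mat (A * Y) = A * Y" "adjoint_mat (Y * A) = Y * A"
    and XY: "A * Y * A * X = A * X" "A * X * A * Y = A * Y" "X * A * Y * A = X * A" "Y * A * X * A = Y * A"
  shows "X = Y"
proof -
  note d = carrier_matD[OF c(1)] carrier_matD[OF c(2)] carrier_matD[OF c(3)]
  have "A * X = adjoint_mat ((A * Y) * (A * X))"
    using X(2) XY(1) d by (simp add: assoc_mult_mat_dim)
  also have "\<dots> = adjoint_mat (A * X) * adjoint_mat (A * Y)"
    using d by (subst adjoint_mat_mult) auto
  also have "\<dots> = A * X * A * Y"
    unfolding X(2) Y(2) using d by (simp add: assoc_mult_mat_dim)
  finally have 1: "A * X = A * Y" using XY(2) by simp
  have "X * A = adjoint_mat ((X * A) * (Y * A))"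
    using X(3) XY(3) d by (simp add: assoc_mult_mat_dim)
  also have "\<dots> = adjoint_mat (Y * A) * adjoint_mat (X * A)"
    using d by (subst adjoint_mat_mult) auto
  also have "\<dots> = Y * A * X * A"
    unfolding X(3) Y(3) using d by (simp add: assoc_mult_mat_dim)
  finally have 2: "X * A = Y * A" using XY(4) by simp
  have "X = X * (A * X)" using X(1) d by (simp add: assoc_mult_mat_dim)
  also have "\<dots> = (X * A) * Y" unfolding 1 using d by (simp add: assoc_mult_mat_dim)
  also have "\<dots> = Y" unfolding 2 by (rule Y(1))
  finally show ?thesis .
qed

section \<open>Standard parts and uniqueness of the dual pseudoinverse\<close>

definition std_mat :: "dual_complex mat \<Rightarrow> complex mat" where
  "std_mat = map_mat std_part"

lemma dim_std_mat [simp]: "dim_row (std_mat A) = dim_row A" "dim_col (std_mat A) = dim_col A"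
  by (simp_all add: std_mat_def)

lemma index_std_mat [simp]:
  "i < dim_row A \<Longrightarrow> j < dim_col A \<Longrightarrow> std_mat A $$ (i, j) = std_part (A $$ (i, j))"
  by (simp add: std_mat_def)

lemma std_mat_mult: "dim_col A = dim_row B \<Longrightarrow> std_mat (A * B) = std_mat A * std_mat B"
  by (rule eq_matI) (auto simp: index_mult_mat_sum std_part_sum simp del: index_mult_mat(1))

lemma std_mat_adjoint: "std_mat (adjoint_mat A) = adjoint_mat (std_mat A)"
  by (rule eq_matI) auto

lemma std_mat_minus:
  "dim_row A = dim_row B \<Longrightarrow> dim_col A = dim_col B \<Longrightarrow> std_mat (A - B) = std_mat A - std_mat B"
  by (rule eq_matI) auto

lemma std_block_diag [simp]: "std_mat (block_diag A D) = block_diag (std_mat A) (std_mat D)"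
  by (rule eq_matI) (auto simp: index_block_diag)

text \<open>As \<epsilon> squares to zero, a product with an infinitesimal matrix sees only the
  standard part of the other factor.\<close>

lemma infinitesimal_mult_cong:
  assumes F: "F \<in> carrier_mat m n" "std_mat F = 0\<^sub>m m n" and XY: "std_mat X = std_mat Y"
  shows "X \<in> carrier_mat n k \<Longrightarrow> Y \<in> carrier_mat n k \<Longrightarrow> F * X = F * Y"
    and "X \<in> carrier_mat k m \<Longrightarrow> Y \<in> carrier_mat k m \<Longrightarrow> X * F = Y * F"
proof -
  have F0: "std_part (F $$ (i, j)) = 0" if "i < m" "j < n" for i j
    using arg_cong[OF F(2), of "\<lambda>M. M $$ (i, j)"] F(1) that by simp
  have XY': "std_part (X $$ (i, j)) = std_part (Y $$ (i, j))"
    if "i < dim_row X" "j < dim_col X" "dim_row Y = dim_row X" "dim_col Y = dim_col X" for i j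
    using arg_cong[OF XY, of "\<lambda>M. M $$ (i, j)"] that by simp
  show "F * X = F * Y" if "X \<in> carrier_mat n k" "Y \<in> carrier_mat n k"
  proof (rule eq_matI)
    fix i j assume "i < dim_row (F * Y)" "j < dim_col (F * Y)"
    then have "F $$ (i, l) * X $$ (l, j) = F $$ (i, l) * Y $$ (l, j)" if "l < n" for l
      using that F(1) F0 XY'[of l j] \<open>X \<in> _\<close> \<open>Y \<in> _\<close> by (intro dual_complex.expand) simp
    then show "(F * X) $$ (i, j) = (F * Y) $$ (i, j)"
      using that F(1) \<open>i < _\<close> \<open>j < _\<close> by (simp add: index_mult_mat_sum del: index_mult_mat(1))
  qed (use that F(1) in auto)
  show "X * F = Y * F" if "X \<in> carrier_mat k m" "Y \<in> carrier_mat k m"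
  proof (rule eq_matI)
    fix i j assume "i < dim_row (Y * F)" "j < dim_col (Y * F)"
    then have "X $$ (i, l) * F $$ (l, j) = Y $$ (i, l) * F $$ (l, j)" if "l < m" for l
      using that F(1) F0 XY'[of i l] \<open>X \<in> _\<close> \<open>Y \<in> _\<close> by (intro dual_complex.expand) simp
    then show "(X * F) $$ (i, j) = (Y * F) $$ (i, j)"
      using that F(1) \<open>i < _\<close> \<open>j < _\<close> by (simp add: index_mult_mat_sum del: index_mult_mat(1))
  qed (use that F(1) in auto)
qed

lemma eq_if_minus_mat_zero:
  fixes A B :: "'a :: group_add mat"
  assumes "A \<in> carrier_mat m n" "B \<in> carrier_mat m n" "A - B = 0\<^sub>m m n"
  shows "A = B"
proof (rule eq_matI)
  fix i j assume "i < dim_row B" "j < dim_col B"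
  then show "A $$ (i, j) = B $$ (i, j)"
    using arg_cong[OF assms(3), of "\<lambda>M. M $$ (i, j)"] assms(1,2) by simp
qed (use assms in auto)

text \<open>Characterizes the NDMPI without reference to the essential part.\<close>

definition is_dual_pinv :: "dual_complex mat \<Rightarrow> dual_complex mat \<Rightarrow> bool" where
  "is_dual_pinv A X \<longleftrightarrow> X \<in> carrier_mat (dim_col A) (dim_row A) \<and> X * A * X = X \<and>
     adjoint_mat (A * X) = A * X \<and> adjoint_mat (X * A) = X * A \<and> std_mat (A * X * A) = std_mat A"

lemma is_dual_pinv_unique:
  assumes X: "is_dual_pinv A X" and Y: "is_dual_pinv A Y"
  shows "X = Y"
proof -
  define m n where "m = dim_row A" and "n = dim_col A"
  have A: "A \<in> carrier_mat m n" by (simp add: m_def n_def)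
  have cX: "X \<in> carrier_mat n m" and X1: "X * A * X = X" and X2: "adjoint_mat (A * X) = A * X"
    and X3: "adjoint_mat (X * A) = X * A" and X4: "std_mat (A * X * A) = std_mat A"
    using X by (auto simp: is_dual_pinv_def m_def n_def)
  have cY: "Y \<in> carrier_mat n m" and Y1: "Y * A * Y = Y" and Y2: "adjoint_mat (A * Y) = A * Y"
    and Y3: "adjoint_mat (Y * A) = Y * A" and Y4: "std_mat (A * Y * A) = std_mat A"
    using Y by (auto simp: is_dual_pinv_def m_def n_def)
  note d = carrier_matD[OF A] carrier_matD[OF cX] carrier_matD[OF cY]
  \<comment> \<open>On standard parts the equation A X A = A holds exactly, so absorption is
    immediate and this is the classical uniqueness of the Moore-Penrose inverse.\<close>
  have std: "std_mat X = std_mat Y"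
  proof (rule penrose_unique)
    show "std_mat A \<in> carrier_mat m n" "std_mat X \<in> carrier_mat n m" "std_mat Y \<in> carrier_mat n m"
      using d by (auto intro!: carrier_matI)
    have XA: "std_mat A * std_mat X * std_mat A = std_mat A" and YA: "std_mat A * std_mat Y * std_mat A = std_mat A"
      using X4 Y4 d by (simp_all add: std_mat_mult)
    show "std_mat X * std_mat A * std_mat X = std_mat X" "std_mat Y * std_mat A * std_mat Y = std_mat Y"
      using arg_cong[OF X1, of std_mat] arg_cong[OF Y1, of std_mat] d by (simp_all add: std_mat_mult)
    show "adjoint_mat (std_mat A * std_mat X) = std_mat A * std_mat X"
      "adjoint_mat (std_mat X * std_mat A) = std_mat X * std_mat A"
      "adjoint_mat (std_mat A * std_mat Y) = std_mat A * std_mat Y"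
      "adjoint_mat (std_mat Y * std_mat A) = std_mat Y * std_mat A"
      using arg_cong[OF X2, of std_mat] arg_cong[OF X3, of std_mat] arg_cong[OF Y2, of std_mat]
        arg_cong[OF Y3, of std_mat] d
      by (simp_all add: std_mat_adjoint std_mat_mult del: adjoint_mat_mult)
    show "std_mat A * std_mat Y * std_mat A * std_mat X = std_mat A * std_mat X"
      "std_mat A * std_mat X * std_mat A * std_mat Y = std_mat A * std_mat Y"
      by (simp_all add: XA YA)
    show "std_mat X * std_mat A * std_mat Y * std_mat A = std_mat X * std_mat A"
      "std_mat Y * std_mat A * std_mat X * std_mat A = std_mat Y * std_mat A"
      using XA YA d by (simp_all add: assoc_mult_mat_dim)
  qed
  \<comment> \<open>The defect \<open>F = A - A * Z * A\<close> is infinitesimal, and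
    \<open>Z * A * Z = Z\<close> makes it annihilate \<open>Z\<close> from both sides. It cannot
    distinguish \<open>W\<close> from \<open>Z\<close>, so it annihilates \<open>W\<close> as well,
    which is the absorption rule.\<close>
  have key: "A * Z * A * W = A * W" "W * A * Z * A = W * A"
    if cZ: "Z \<in> carrier_mat n m" and cW: "W \<in> carrier_mat n m" and Z: "Z * A * Z = Z"
      and Z4: "std_mat (A * Z * A) = std_mat A" and ZW: "std_mat W = std_mat Z" for Z W
  proof -
    define F where "F = A - A * Z * A"
    have F: "F \<in> carrier_mat m n" using A cZ by (auto simp: F_def)
    have "std_mat F = 0\<^sub>m m n"
      using d cZ by (simp add: F_def std_mat_minus Z4 del: assoc_mult_mat)
        (auto intro!: eq_matI)
    note cong = infinitesimal_mult_cong[OF F this ZW, of m] infinitesimal_mult_cong[OF F this ZW, of n]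
    have AZA: "A * Z * A \<in> carrier_mat m n" using A cZ by auto
    have ZAZ: "Z * (A * (Z * B)) = Z * B" if "dim_row B = m" for B
      using arg_cong[OF Z, of "\<lambda>M. M * B"] d carrier_matD[OF cZ] that by (simp add: assoc_mult_mat_dim)
    have "F * W = F * Z" using cong(1) cZ cW by simp
    also have "\<dots> = 0\<^sub>m m m"
      unfolding F_def minus_mult_distrib_mat[OF A AZA cZ]
      using arg_cong[OF Z, of "\<lambda>M. A * M"] d cZ A by (simp add: assoc_mult_mat_dim)
    finally have "A * W - A * Z * A * W = 0\<^sub>m m m"
      unfolding F_def minus_mult_distrib_mat[OF A AZA cW] .
    then show "A * Z * A * W = A * W"
      using A cZ cW by - (rule eq_if_minus_mat_zero[of "A * W" m m "A * Z * A * W", symmetric], auto)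
    have "W * F = Z * F" using cong(4) cZ cW by simp
    also have "\<dots> = 0\<^sub>m n n"
      unfolding F_def mult_minus_distrib_mat[OF cZ A AZA]
      using ZAZ[of A] d cZ A by (simp add: assoc_mult_mat_dim)
    finally have "W * A - W * (A * Z * A) = 0\<^sub>m n n"
      unfolding F_def mult_minus_distrib_mat[OF cW A AZA] .
    then have "W * A = W * (A * Z * A)"
      using A cZ cW by - (rule eq_if_minus_mat_zero[of _ n n], auto)
    moreover have "W * A * Z * A = W * (A * Z * A)"
      using d carrier_matD[OF cZ] carrier_matD[OF cW] by (simp add: assoc_mult_mat_dim)
    ultimately show "W * A * Z * A = W * A" by simp
  qed
  show ?thesis
    by (rule penrose_unique[OF A cX cY X1 X2 X3 Y1 Y2 Y3 key(1)[OF cY cX Y1 Y4 std]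
          key(1)[OF cX cY X1 X4 std[symmetric]] key(2)[OF cY cX Y1 Y4 std] key(2)[OF cX cY X1 X4 std[symmetric]]])
qed

section \<open>The pseudoinverse of an SVD and the essential part\<close>

text \<open>First-order expansion of 1/(a + b \<epsilon>); an inverse only when the standard part is
  nonzero.\<close>

definition dual_inverse :: "dual_complex \<Rightarrow> dual_complex" where
  "dual_inverse x = Dual (inverse (std_part x)) (- inf_part x / (std_part x)\<^sup>2)"

lemma dual_inverse_mult: "std_part x \<noteq> 0 \<Longrightarrow> x * dual_inverse x = 1"
  by (rule dual_complex.expand) (simp add: dual_inverse_def power2_eq_square field_simps)

text \<open>Invert \<open>S1\<close>, replace \<open>S2\<close> by zero, and swap the unitaries. All
  products then reduce to the diagonal middle factors, and the lost block \<open>S2\<close> is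
  infinitesimal, so \<open>A * X * A\<close> keeps the standard part of \<open>A\<close>.\<close>

lemma is_svd_dual_pinv:
  assumes svd: "is_svd A r U S1 S2 V"
  obtains X where "is_dual_pinv A X"
    "A * X * A = U * four_block_mat S1 (0\<^sub>m r (dim_col A - r)) (0\<^sub>m (dim_row A - r) r)
       (0\<^sub>m (dim_row A - r) (dim_col A - r)) * conj_transpose V"
proof -
  define m n where "m = dim_row A" and "n = dim_col A"
  have r: "r \<le> m" "r \<le> n" and U: "unitary_mat m U" and V: "unitary_mat n V"
    and S1: "S1 \<in> carrier_mat r r" and S1_diag: "diagonal_mat S1"
    and S1_pos: "\<And>i. i < r \<Longrightarrow> positive_appreciable (S1 $$ (i, i))"
    and S2: "S2 \<in> carrier_mat (m - r) (n - r)" and S2_diag: "diagonal_mat S2"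
    and S2_inf: "\<And>i. i < min (m - r) (n - r) \<Longrightarrow>
      positive_infinitesimal (S2 $$ (i, i)) \<or> S2 $$ (i, i) = 0"
    and A_svd: "A = U * four_block_mat S1 (0\<^sub>m r (n - r)) (0\<^sub>m (m - r) r) S2 * adjoint_mat V"
    using svd unfolding is_svd_def Let_def m_def[symmetric] n_def[symmetric]
      unitary_dual_eq conj_transpose_eq_adjoint by blast+
  define T where "T = mat r r (\<lambda>(i, j). if i = j then dual_inverse (S1 $$ (i, i)) else 0)"
  define M where "M = block_diag S1 S2"
  define E where "E = block_diag S1 (0\<^sub>m (m - r) (n - r))"
  define N where "N = block_diag T (0\<^sub>m (n - r) (m - r))"
  have T: "T \<in> carrier_mat r r" by (simp add: T_def)
  have inv: "S1 $$ (i, i) * dual_inverse (S1 $$ (i, i)) = 1" if "i < r" for i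
    using S1_pos[OF that] by (intro dual_inverse_mult) (auto simp: positive_appreciable_def)
  have ST: "S1 * T = 1\<^sub>m r"
  proof (rule eq_matI)
    fix i j assume "i < dim_row (1\<^sub>m r :: dual_complex mat)" "j < dim_col (1\<^sub>m r :: dual_complex mat)"
    then have ij: "i < r" "j < r" by auto
    have "(S1 * T) $$ (i, j) = (\<Sum>k<r. S1 $$ (i, k) * T $$ (k, j))"
      using S1 T ij by (subst index_mult_mat_sum) auto
    also have "\<dots> = (\<Sum>k<r. if k = j then if i = j then 1 else 0 else 0)"
      using S1 S1_diag ij inv by (intro sum.cong) (auto simp: T_def diagonal_mat_def)
    finally show "(S1 * T) $$ (i, j) = 1\<^sub>m r $$ (i, j)" using ij by (simp add: sum_delta_lessThan)
  qed (use S1 T in auto)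
  have TS: "T * S1 = 1\<^sub>m r"
  proof (rule eq_matI)
    fix i j assume "i < dim_row (1\<^sub>m r :: dual_complex mat)" "j < dim_col (1\<^sub>m r :: dual_complex mat)"
    then have ij: "i < r" "j < r" by auto
    have "(T * S1) $$ (i, j) = (\<Sum>k<r. T $$ (i, k) * S1 $$ (k, j))"
      using S1 T ij by (subst index_mult_mat_sum) auto
    also have "\<dots> = (\<Sum>k<r. if k = i then if i = j then 1 else 0 else 0)"
      using S1 S1_diag ij inv
      by (intro sum.cong) (auto simp: T_def diagonal_mat_def mult.commute[of "dual_inverse _"])
    finally show "(T * S1) $$ (i, j) = 1\<^sub>m r $$ (i, j)" using ij by (simp add: sum_delta_lessThan)
  qed (use S1 T in auto)
  have d: "dim_row S1 = r" "dim_col S1 = r" "dim_row S2 = m - r" "dim_col S2 = n - r"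
      "dim_row T = r" "dim_col T = r"
    using S1 S2 T by auto
  have MN: "M * N = block_diag (1\<^sub>m r) (0\<^sub>m (m - r) (m - r))"
    and NM: "N * M = block_diag (1\<^sub>m r) (0\<^sub>m (n - r) (n - r))"
    using S2 by (simp_all add: M_def N_def d ST TS)
  have dims: "dim_row M = m" "dim_col M = n" "dim_row E = m" "dim_col E = n" "dim_row N = n" "dim_col N = m"
    using r by (simp_all add: M_def E_def N_def d)
  have MNM: "M * N * M = E"
    unfolding MN using S1 S2 by (simp add: M_def E_def d)
  have NMN: "N * M * N = N"
    unfolding NM using T by (simp add: N_def d)
  have A_eq: "A = U * M * adjoint_mat V"
    using A_svd by (simp add: M_def block_diag_def d)
  define X where "X = V * N * adjoint_mat U"
  note Ud = unitary_matD(2,3)[OF U] and Vd = unitary_matD(2,3)[OF V]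
  have dA: "dim_row A = m" "dim_col A = n" by (simp_all add: m_def n_def)
  have AX: "A * X = U * (M * N) * adjoint_mat U"
    unfolding A_eq X_def using dims Ud Vd by (simp add: assoc_mult_mat_dim unitary_mat_cancel[OF V])
  have XA: "X * A = V * (N * M) * adjoint_mat V"
    unfolding A_eq X_def using dims Ud Vd by (simp add: assoc_mult_mat_dim unitary_mat_cancel[OF U])
  have AXA: "A * X * A = U * E * adjoint_mat V"
    unfolding AX unfolding A_eq MNM[symmetric]
    using dims Ud Vd by (simp add: assoc_mult_mat_dim unitary_mat_cancel[OF U])
  have "X * A * X = V * (N * M * N) * adjoint_mat U"
    unfolding XA unfolding X_def
    using dims Ud Vd by (simp add: assoc_mult_mat_dim unitary_mat_cancel[OF V])
  then have XAX: "X * A * X = X" by (simp add: NMN X_def)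
  have AX_herm: "adjoint_mat (A * X) = A * X"
    unfolding AX MN using r Ud by (simp add: assoc_mult_mat_dim)
  have XA_herm: "adjoint_mat (X * A) = X * A"
    unfolding XA NM using r Vd by (simp add: assoc_mult_mat_dim)
  have "std_mat S2 = std_mat (0\<^sub>m (m - r) (n - r))"
  proof (rule eq_matI)
    fix i j assume "i < dim_row (std_mat (0\<^sub>m (m - r) (n - r)))" "j < dim_col (std_mat (0\<^sub>m (m - r) (n - r)))"
    then have "i < m - r" "j < n - r" by auto
    then show "std_mat S2 $$ (i, j) = std_mat (0\<^sub>m (m - r) (n - r)) $$ (i, j)"
      using S2 S2_diag S2_inf[of i] d
      by (cases "i = j") (auto simp: diagonal_mat_def positive_infinitesimal_def)
  qed (use d in auto)
  then have "std_mat M = std_mat E" by (simp add: M_def E_def)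
  then have "std_mat (A * X * A) = std_mat A"
    unfolding AXA unfolding A_eq using dims Ud Vd by (simp add: std_mat_mult)
  moreover have "X \<in> carrier_mat n m"
    unfolding X_def using dims Ud Vd by (intro carrier_matI) simp_all
  ultimately have "is_dual_pinv A X"
    using XAX AX_herm XA_herm by (simp add: is_dual_pinv_def dA)
  moreover have "A * X * A = U * four_block_mat S1 (0\<^sub>m r (dim_col A - r)) (0\<^sub>m (dim_row A - r) r)
       (0\<^sub>m (dim_row A - r) (dim_col A - r)) * conj_transpose V"
    unfolding AXA E_def block_diag_def conj_transpose_eq_adjoint by (simp add: d dA)
  ultimately show thesis by (rule that)
qed

text \<open>Each SVD yields a pseudoinverse \<open>Y\<close> whose \<open>A * Y * A\<close> is the
  candidate built from that SVD. Uniqueness gives \<open>Y = X\<close>, so all candidates coincide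
  and the definite description is well defined.\<close>

lemma essential_part_eq:
  assumes X: "is_dual_pinv A X"
  shows "essential_part A = A * X * A"
  unfolding essential_part_def Let_def
proof (rule the_equality)
  obtain r U S1 S2 V where svd: "is_svd A r U S1 S2 V" by (rule dual_svd_exists)
  obtain Y where "is_dual_pinv A Y" and "A * Y * A = U * four_block_mat S1 (0\<^sub>m r (dim_col A - r))
      (0\<^sub>m (dim_row A - r) r) (0\<^sub>m (dim_row A - r) (dim_col A - r)) * conj_transpose V"
    using svd by (rule is_svd_dual_pinv)
  then show "\<exists>r U S1 S2 V. is_svd A r U S1 S2 V \<and> A * X * A = U * four_block_mat S1
      (0\<^sub>m r (dim_col A - r)) (0\<^sub>m (dim_row A - r) r) (0\<^sub>m (dim_row A - r) (dim_col A - r)) * conj_transpose V"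
    using svd is_dual_pinv_unique[OF X] by blast
next
  fix E assume "\<exists>r U S1 S2 V. is_svd A r U S1 S2 V \<and> E = U * four_block_mat S1
      (0\<^sub>m r (dim_col A - r)) (0\<^sub>m (dim_row A - r) r) (0\<^sub>m (dim_row A - r) (dim_col A - r)) * conj_transpose V"
  then obtain r U S1 S2 V where svd: "is_svd A r U S1 S2 V" and E: "E = U * four_block_mat S1
      (0\<^sub>m r (dim_col A - r)) (0\<^sub>m (dim_row A - r) r) (0\<^sub>m (dim_row A - r) (dim_col A - r)) * conj_transpose V"
    by blast
  obtain Y where "is_dual_pinv A Y" and "A * Y * A = E"
    using is_svd_dual_pinv[OF svd] unfolding E by metis
  then show "E = A * X * A" using is_dual_pinv_unique[OF X] by blast
qed

text \<open>The essential part equals \<open>A * Y * A\<close> for a pseudoinverse \<open>Y\<close>,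
  hence has the standard part of \<open>A\<close>; this turns equation (1) into the condition on
  standard parts.\<close>

lemma is_ndmpi_iff_dual_pinv: "is_ndmpi A X \<longleftrightarrow> is_dual_pinv A X"
proof
  obtain r U S1 S2 V where svd: "is_svd A r U S1 S2 V" by (rule dual_svd_exists)
  obtain Y where Y: "is_dual_pinv A Y" using is_svd_dual_pinv[OF svd] by blast
  assume "is_ndmpi A X"
  then show "is_dual_pinv A X"
    using Y essential_part_eq[OF Y] by (simp add: is_ndmpi_def is_dual_pinv_def conj_transpose_eq_adjoint)
next
  assume X: "is_dual_pinv A X"
  then show "is_ndmpi A X"
    using essential_part_eq[OF X] by (simp add: is_ndmpi_def is_dual_pinv_def conj_transpose_eq_adjoint)
qed

section \<open>The NDMPI and the reverse order law\<close>

lemma is_ndmpi_ndmpi: "is_ndmpi A (ndmpi A)"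
proof -
  obtain r U S1 S2 V where svd: "is_svd A r U S1 S2 V" by (rule dual_svd_exists)
  obtain X where X: "is_dual_pinv A X" using is_svd_dual_pinv[OF svd] by blast
  show ?thesis
    unfolding ndmpi_def
    by (rule theI[of _ X]) (use X is_dual_pinv_unique in \<open>auto simp: is_ndmpi_iff_dual_pinv\<close>)
qed

lemma ndmpi_mult_123_inverse:
  assumes "is_123_inverse B X"
  shows "ndmpi B * B * X = ndmpi B"
proof -
  define Y where "Y = ndmpi B"
  have Y: "is_ndmpi B Y" unfolding Y_def by (rule is_ndmpi_ndmpi)
  have d: "dim_row X = dim_col B" "dim_col X = dim_row B" "dim_row Y = dim_col B" "dim_col Y = dim_row B"
    using assms Y by (auto simp: is_123_inverse_def is_ndmpi_def)
  \<comment> \<open>Both products are the essential part of \<open>B\<close>. This replaces B X B =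
    B in the classical argument.\<close>
  have e: "B * X * B = B * Y * B" and X: "X * B * X = X" and Yi: "Y * B * Y = Y"
    and hX: "adjoint_mat (B * X) = B * X" and hY: "adjoint_mat (B * Y) = B * Y"
    using assms Y by (simp_all add: is_123_inverse_def is_ndmpi_def conj_transpose_eq_adjoint)
  have "B * X = B * (X * B * X)" by (simp only: X)
  also have "\<dots> = B * X * B * X" using d by (simp add: assoc_mult_mat_dim)
  also have "\<dots> = B * Y * (B * X)" unfolding e using d by (simp add: assoc_mult_mat_dim)
  finally have "adjoint_mat (B * X) = adjoint_mat (B * Y * (B * X))" by simp
  also have "\<dots> = adjoint_mat (B * X) * adjoint_mat (B * Y)"
    using d by (subst adjoint_mat_mult) auto
  \<comment> \<open>The adjoint reverses the order of the two projections, so that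
    \<open>B * X * B\<close> can now be exchanged for \<open>B * Y * B\<close> and the product
    collapses to \<open>B * Y\<close>.\<close>
  finally have "B * X = B * X * (B * Y)" unfolding hX hY .
  also have "\<dots> = B * X * B * Y" using d by (simp add: assoc_mult_mat_dim)
  also have "\<dots> = B * (Y * B * Y)" unfolding e using d by (simp add: assoc_mult_mat_dim)
  finally have "B * X = B * Y" unfolding Yi .
  then have "Y * B * X = Y * B * Y" using d by (simp add: assoc_mult_mat_dim)
  then show ?thesis by (simp add: Yi flip: Y_def)
qed

theorem theorem3p9:
  fixes A B :: "dual_complex mat" and m q n :: nat
  assumes "A \<in> carrier_mat m q"
    and "B \<in> carrier_mat q n"
  shows "ndmpi (A * B) = ndmpi B * ndmpi A \<longleftrightarrow>
    (\<exists>X. is_123_inverse B X \<and> ndmpi (A * B) = ndmpi B * B * X * ndmpi A)"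
proof
  \<comment> \<open>For every {1,2,3}-inverse \<open>X\<close> the product
    \<open>ndmpi B * B * X * ndmpi A\<close> is \<open>ndmpi B * ndmpi A\<close>, so both directions
    follow once one such \<open>X\<close> is exhibited.\<close>
  have "is_123_inverse B (ndmpi B)"
    using is_ndmpi_ndmpi[of B] by (auto simp: is_ndmpi_def is_123_inverse_def)
  moreover assume "ndmpi (A * B) = ndmpi B * ndmpi A"
  ultimately show "\<exists>X. is_123_inverse B X \<and> ndmpi (A * B) = ndmpi B * B * X * ndmpi A"
    using ndmpi_mult_123_inverse by metis
next
  assume "\<exists>X. is_123_inverse B X \<and> ndmpi (A * B) = ndmpi B * B * X * ndmpi A"
  then show "ndmpi (A * B) = ndmpi B * ndmpi A"
    using ndmpi_mult_123_inverse by metis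
qed

end
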